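(* Let $R=\mathbb F_q[X;\sigma]/(X^2)$ for some $\sigma\in\mathrm{Aut}(\mathbb F_q)$. Let $K$ be the orbit of a point $p$ of the Barbilian space of $R^3_R$ under an embedded Singer cycle, $K$ being a set of $q^2+q+1$ points that shares exactly $1$ or $q+1$ points with every hyperplane of the Barbilian space. Let $Y$ be a $3\times(q^2+q+1)$ matrix over $R$ whose columns generate the points of $K$. Then the left linear code $\{xY\mid x\in R^3\}$ generated by $Y$, which is $3$-generated of length $q^2+q+1$, is a two-weight code with normalized homogeneous weights $$w_1=\frac{q^3}{q-1}\quad\text{and}\quad w_2=q^2.$$
   Context: $\mathbb F_q[X;\sigma]$ is the skew polynomial ring with $Xa=\sigma(a)X$ for $a\in\mathbb F_q$; $R=\mathbb F_q[X;\sigma]/(X^2)$ is a finite chain ring of length $2$ with $\mathrm{Rad}(R)=RX$, residue field $\mathbb F_q$, and contains $\mathbb F_q$ as the subring of constants. Points of the Barbilian space of $R^3_R$ are the submodules $xR$, $x\in R^3$, with $\varphi(x)=1$ for some $\varphi\in \mathrm{Hom}(R^3_R,R_R)$; hyperplanes are the submodules $R\varphi$, $\varphi\in\mathrm{Hom}(R^3_R,R_R)$, with $\varphi(x)=1$ for some $x\in R^3$; the point $xR$ lies on the hyperplane $R\varphi$ iff $\varphi(x)=0$. A Singer cycle of $\mathrm{PGL}(3,\mathbb F_q)$ is a cyclic group of order $q^2+q+1$ acting regularly on the points of $\mathrm{PG}(2,q)$. It is embedded as follows: it is induced by a matrix $S\in\mathrm{GL}(3,\mathbb F_q)$, which is regarded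 as a matrix over $R$ via $\mathbb F_q\subseteq R$ and acts on points by $xR\mapsto (Sx)R$; the orbit of $p$ is its orbit under the group generated by $S$. The normalized homogeneous weight $\mathrm{w}_{\mathrm{hom}}$ on $R$ is the unique map $w:R\to\mathbb R_{\ge0}$ with $w(0)=0$, $w(x)=w(y)$ whenever $Rx=Ry$, and $\sum_{y\in Rx}w(y)=|Rx|$ for all $x\neq0$; here it is $0$ at $0$, $\frac{q}{q-1}$ on $\mathrm{Rad}(R)\setminus\{0\}$, and $1$ on units. It is extended to $R^n$ by summing over coordinates. A two-weight code is a linear code $C\le{}_RR^n$ with $\mathrm{w}_{\mathrm{hom}}(c)>0$ for all nonzero $c\in C$ and on which the homogeneous weight takes exactly two nonzero values. *)

theory Defs
  imports Complex_Main "HOL-Algebra.Algebra"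
begin

section \<open>The chain ring \<open>F[X; \<sigma>] / (X\<^sup>2)\<close>\<close>

text \<open>Skew polynomials are coefficient sequences, with coefficients written on the left of the
  powers of \<open>X\<close>. The rule \<open>X a = \<sigma>(a) X\<close> gives \<open>(a X\<^sup>i) (b X\<^sup>j) = a \<sigma>\<^sup>i(b) X\<^sup>i\<^sup>+\<^sup>j\<close>.\<close>

definition skew_poly :: "('a, 'm) ring_scheme \<Rightarrow> ('a \<Rightarrow> 'a) \<Rightarrow> (nat \<Rightarrow> 'a) ring" where
  "skew_poly F \<sigma> =
    \<lparr>carrier = up F,
     monoid.mult = (\<lambda>f g n. \<Oplus>\<^bsub>F\<^esub>i\<in>{..n}. f i \<otimes>\<^bsub>F\<^esub> (\<sigma> ^^ i) (g (n - i))),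
     one = (\<lambda>n. if n = 0 then \<one>\<^bsub>F\<^esub> else \<zero>\<^bsub>F\<^esub>),
     ring.zero = (\<lambda>n. \<zero>\<^bsub>F\<^esub>),
     ring.add = (\<lambda>f g n. f n \<oplus>\<^bsub>F\<^esub> g n)\<rparr>"

definition skew_X :: "('a, 'm) ring_scheme \<Rightarrow> nat \<Rightarrow> 'a" where
  "skew_X F = (\<lambda>n. if n = 1 then \<one>\<^bsub>F\<^esub> else \<zero>\<^bsub>F\<^esub>)"

definition X2_ideal :: "('a, 'm) ring_scheme \<Rightarrow> ('a \<Rightarrow> 'a) \<Rightarrow> (nat \<Rightarrow> 'a) set" where
  "X2_ideal F \<sigma> = Idl\<^bsub>skew_poly F \<sigma>\<^esub> {skew_X F [^]\<^bsub>skew_poly F \<sigma>\<^esub> (2::nat)}"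

definition skew_chain_ring :: "('a, 'm) ring_scheme \<Rightarrow> ('a \<Rightarrow> 'a) \<Rightarrow> (nat \<Rightarrow> 'a) set ring" where
  "skew_chain_ring F \<sigma> = skew_poly F \<sigma> Quot X2_ideal F \<sigma>"

definition const_embed :: "('a, 'm) ring_scheme \<Rightarrow> ('a \<Rightarrow> 'a) \<Rightarrow> 'a \<Rightarrow> (nat \<Rightarrow> 'a) set" where
  "const_embed F \<sigma> a = X2_ideal F \<sigma> +>\<^bsub>skew_poly F \<sigma>\<^esub> (\<lambda>n. if n = 0 then a else \<zero>\<^bsub>F\<^esub>)"


section \<open>Vectors and matrices over a possibly noncommutative ring\<close>

definition vecs :: "('a, 'm) ring_scheme \<Rightarrow> nat \<Rightarrow> (nat \<Rightarrow> 'a) set" where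
  "vecs R n = {..<n} \<rightarrow>\<^sub>E carrier R"

definition vec_add :: "('a, 'm) ring_scheme \<Rightarrow> nat \<Rightarrow> (nat \<Rightarrow> 'a) \<Rightarrow> (nat \<Rightarrow> 'a) \<Rightarrow> nat \<Rightarrow> 'a" where
  "vec_add R n x y = (\<lambda>i\<in>{..<n}. x i \<oplus>\<^bsub>R\<^esub> y i)"

definition vec_zero :: "('a, 'm) ring_scheme \<Rightarrow> nat \<Rightarrow> nat \<Rightarrow> 'a" where
  "vec_zero R n = (\<lambda>i\<in>{..<n}. \<zero>\<^bsub>R\<^esub>)"

definition vec_lsmult :: "('a, 'm) ring_scheme \<Rightarrow> nat \<Rightarrow> 'a \<Rightarrow> (nat \<Rightarrow> 'a) \<Rightarrow> nat \<Rightarrow> 'a" where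
  "vec_lsmult R n r x = (\<lambda>i\<in>{..<n}. r \<otimes>\<^bsub>R\<^esub> x i)"

definition vec_rsmult :: "('a, 'm) ring_scheme \<Rightarrow> nat \<Rightarrow> (nat \<Rightarrow> 'a) \<Rightarrow> 'a \<Rightarrow> nat \<Rightarrow> 'a" where
  "vec_rsmult R n x r = (\<lambda>i\<in>{..<n}. x i \<otimes>\<^bsub>R\<^esub> r)"

definition mats :: "('a, 'm) ring_scheme \<Rightarrow> nat \<Rightarrow> nat \<Rightarrow> (nat \<Rightarrow> nat \<Rightarrow> 'a) set" where
  "mats R m n = {..<m} \<rightarrow>\<^sub>E ({..<n} \<rightarrow>\<^sub>E carrier R)"

definition scalar_mat :: "('a, 'm) ring_scheme \<Rightarrow> nat \<Rightarrow> 'a \<Rightarrow> nat \<Rightarrow> nat \<Rightarrow> 'a" where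
  "scalar_mat R n a = (\<lambda>i\<in>{..<n}. \<lambda>j\<in>{..<n}. if i = j then a else \<zero>\<^bsub>R\<^esub>)"

definition mat_monoid :: "('a, 'm) ring_scheme \<Rightarrow> nat \<Rightarrow> (nat \<Rightarrow> nat \<Rightarrow> 'a) monoid" where
  "mat_monoid R n =
    \<lparr>carrier = mats R n n,
     monoid.mult = (\<lambda>A B. \<lambda>i\<in>{..<n}. \<lambda>j\<in>{..<n}. \<Oplus>\<^bsub>R\<^esub>k\<in>{..<n}. A i k \<otimes>\<^bsub>R\<^esub> B k j),
     one = scalar_mat R n \<one>\<^bsub>R\<^esub>\<rparr>"

definition mat_vec :: "('a, 'm) ring_scheme \<Rightarrow> nat \<Rightarrow> (nat \<Rightarrow> nat \<Rightarrow> 'a) \<Rightarrow> (nat \<Rightarrow> 'a) \<Rightarrow> nat \<Rightarrow> 'a" where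
  "mat_vec R n A x = (\<lambda>i\<in>{..<n}. \<Oplus>\<^bsub>R\<^esub>k\<in>{..<n}. A i k \<otimes>\<^bsub>R\<^esub> x k)"

definition vec_mat :: "('a, 'm) ring_scheme \<Rightarrow> nat \<Rightarrow> nat \<Rightarrow> (nat \<Rightarrow> 'a) \<Rightarrow> (nat \<Rightarrow> nat \<Rightarrow> 'a) \<Rightarrow> nat \<Rightarrow> 'a" where
  "vec_mat R m n x A = (\<lambda>j\<in>{..<n}. \<Oplus>\<^bsub>R\<^esub>i\<in>{..<m}. x i \<otimes>\<^bsub>R\<^esub> A i j)"

definition mat_col :: "nat \<Rightarrow> (nat \<Rightarrow> nat \<Rightarrow> 'a) \<Rightarrow> nat \<Rightarrow> nat \<Rightarrow> 'a" where
  "mat_col m A j = (\<lambda>i\<in>{..<m}. A i j)"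


section \<open>The Barbilian space of the right module \<open>R\<^sup>n\<close>\<close>

definition right_span :: "('a, 'm) ring_scheme \<Rightarrow> nat \<Rightarrow> (nat \<Rightarrow> 'a) \<Rightarrow> (nat \<Rightarrow> 'a) set" where
  "right_span R n x = {vec_rsmult R n x r | r. r \<in> carrier R}"

definition right_forms :: "('a, 'm) ring_scheme \<Rightarrow> nat \<Rightarrow> ((nat \<Rightarrow> 'a) \<Rightarrow> 'a) set" where
  "right_forms R n = {\<phi> \<in> vecs R n \<rightarrow>\<^sub>E carrier R.
     (\<forall>x\<in>vecs R n. \<forall>y\<in>vecs R n. \<phi> (vec_add R n x y) = \<phi> x \<oplus>\<^bsub>R\<^esub> \<phi> y) \<and>
     (\<forall>x\<in>vecs R n. \<forall>r\<in>carrier R. \<phi> (vec_rsmult R n x r) = \<phi> x \<otimes>\<^bsub>R\<^esub> r)}"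

definition form_span :: "('a, 'm) ring_scheme \<Rightarrow> nat \<Rightarrow> ((nat \<Rightarrow> 'a) \<Rightarrow> 'a) \<Rightarrow> ((nat \<Rightarrow> 'a) \<Rightarrow> 'a) set" where
  "form_span R n \<phi> = {(\<lambda>x\<in>vecs R n. r \<otimes>\<^bsub>R\<^esub> \<phi> x) | r. r \<in> carrier R}"

definition barbilian_points :: "('a, 'm) ring_scheme \<Rightarrow> nat \<Rightarrow> (nat \<Rightarrow> 'a) set set" where
  "barbilian_points R n =
     {right_span R n x | x. x \<in> vecs R n \<and> (\<exists>\<phi>\<in>right_forms R n. \<phi> x = \<one>\<^bsub>R\<^esub>)}"

definition barbilian_hyperplanes :: "('a, 'm) ring_scheme \<Rightarrow> nat \<Rightarrow> ((nat \<Rightarrow> 'a) \<Rightarrow> 'a) set set" where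
  "barbilian_hyperplanes R n =
     {form_span R n \<phi> | \<phi>. \<phi> \<in> right_forms R n \<and> (\<exists>x\<in>vecs R n. \<phi> x = \<one>\<^bsub>R\<^esub>)}"

definition lies_on :: "('a, 'm) ring_scheme \<Rightarrow> nat \<Rightarrow> (nat \<Rightarrow> 'a) set \<Rightarrow> ((nat \<Rightarrow> 'a) \<Rightarrow> 'a) set \<Rightarrow> bool" where
  "lies_on R n P H \<longleftrightarrow> (\<exists>x\<in>vecs R n. \<exists>\<phi>\<in>right_forms R n.
     P = right_span R n x \<and> H = form_span R n \<phi> \<and> \<phi> x = \<zero>\<^bsub>R\<^esub>)"


section \<open>Singer cycles of \<open>PGL(3, F)\<close>\<close>

definition GL :: "('a, 'm) ring_scheme \<Rightarrow> nat \<Rightarrow> (nat \<Rightarrow> nat \<Rightarrow> 'a) monoid" where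
  "GL F n = units_of (mat_monoid F n)"

definition scalar_mats :: "('a, 'm) ring_scheme \<Rightarrow> nat \<Rightarrow> (nat \<Rightarrow> nat \<Rightarrow> 'a) set" where
  "scalar_mats F n = {scalar_mat F n a | a. a \<in> carrier F - {\<zero>\<^bsub>F\<^esub>}}"

definition PGL :: "('a, 'm) ring_scheme \<Rightarrow> nat \<Rightarrow> (nat \<Rightarrow> nat \<Rightarrow> 'a) set monoid" where
  "PGL F n = GL F n Mod scalar_mats F n"

definition PG_points :: "('a, 'm) ring_scheme \<Rightarrow> nat \<Rightarrow> (nat \<Rightarrow> 'a) set set" where
  "PG_points F n = {right_span F n x | x. x \<in> vecs F n \<and> x \<noteq> vec_zero F n}"

text \<open>The image of a submodule under a matrix; in particular \<open>xR\<close> is sent to \<open>(Ax)R\<close>.\<close>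

definition mat_act :: "('a, 'm) ring_scheme \<Rightarrow> nat \<Rightarrow> (nat \<Rightarrow> nat \<Rightarrow> 'a) \<Rightarrow> (nat \<Rightarrow> 'a) set \<Rightarrow> (nat \<Rightarrow> 'a) set" where
  "mat_act R n A P = mat_vec R n A ` P"

text \<open>An element of \<open>PGL\<close> is a coset of matrices, all of which act alike on the points of the
  projective space; so the union below is the common image of the point.\<close>

definition PGL_act :: "('a, 'm) ring_scheme \<Rightarrow> nat \<Rightarrow> (nat \<Rightarrow> nat \<Rightarrow> 'a) set \<Rightarrow> (nat \<Rightarrow> 'a) set \<Rightarrow> (nat \<Rightarrow> 'a) set" where
  "PGL_act F n g P = (\<Union>A\<in>g. mat_act F n A P)"

definition singer_cycle :: "('a, 'm) ring_scheme \<Rightarrow> (nat \<Rightarrow> nat \<Rightarrow> 'a) set set \<Rightarrow> bool" where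
  "singer_cycle F C \<longleftrightarrow>
     subgroup C (PGL F 3) \<and>
     cyclic_group ((PGL F 3)\<lparr>carrier := C\<rparr>) \<and>
     card C = card (carrier F) ^ 2 + card (carrier F) + 1 \<and>
     (\<forall>P\<in>PG_points F 3. \<forall>Q\<in>PG_points F 3. \<exists>!g. g \<in> C \<and> PGL_act F 3 g P = Q)"

definition const_embed_mat ::
    "('a, 'm) ring_scheme \<Rightarrow> ('a \<Rightarrow> 'a) \<Rightarrow> nat \<Rightarrow> (nat \<Rightarrow> nat \<Rightarrow> 'a) \<Rightarrow> nat \<Rightarrow> nat \<Rightarrow> (nat \<Rightarrow> 'a) set" where
  "const_embed_mat F \<sigma> n A = (\<lambda>i\<in>{..<n}. \<lambda>j\<in>{..<n}. const_embed F \<sigma> (A i j))"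

definition embedded_orbit ::
    "('a, 'm) ring_scheme \<Rightarrow> ('a \<Rightarrow> 'a) \<Rightarrow> (nat \<Rightarrow> nat \<Rightarrow> 'a) \<Rightarrow> (nat \<Rightarrow> (nat \<Rightarrow> 'a) set) set
      \<Rightarrow> (nat \<Rightarrow> (nat \<Rightarrow> 'a) set) set set" where
  "embedded_orbit F \<sigma> S p =
     {mat_act (skew_chain_ring F \<sigma>) 3 (const_embed_mat F \<sigma> 3 A) p | A. A \<in> generate (GL F 3) {S}}"


section \<open>Linear codes and the homogeneous weight\<close>

definition left_ideal_gen :: "('a, 'm) ring_scheme \<Rightarrow> 'a \<Rightarrow> 'a set" where
  "left_ideal_gen R x = {r \<otimes>\<^bsub>R\<^esub> x | r. r \<in> carrier R}"

definition is_homogeneous_weight :: "('a, 'm) ring_scheme \<Rightarrow> ('a \<Rightarrow> real) \<Rightarrow> bool" where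
  "is_homogeneous_weight R w \<longleftrightarrow>
     w \<in> carrier R \<rightarrow>\<^sub>E {0..} \<and>
     w \<zero>\<^bsub>R\<^esub> = 0 \<and>
     (\<forall>x\<in>carrier R. \<forall>y\<in>carrier R. left_ideal_gen R x = left_ideal_gen R y \<longrightarrow> w x = w y) \<and>
     (\<forall>x\<in>carrier R - {\<zero>\<^bsub>R\<^esub>}. (\<Sum>y\<in>left_ideal_gen R x. w y) = real (card (left_ideal_gen R x)))"

definition whom :: "('a, 'm) ring_scheme \<Rightarrow> 'a \<Rightarrow> real" where
  "whom R = (THE w. is_homogeneous_weight R w)"

definition whom_vec :: "('a, 'm) ring_scheme \<Rightarrow> nat \<Rightarrow> (nat \<Rightarrow> 'a) \<Rightarrow> real" where
  "whom_vec R n c = (\<Sum>j<n. whom R (c j))"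

definition left_linear_code :: "('a, 'm) ring_scheme \<Rightarrow> nat \<Rightarrow> (nat \<Rightarrow> 'a) set \<Rightarrow> bool" where
  "left_linear_code R n C \<longleftrightarrow>
     C \<subseteq> vecs R n \<and> vec_zero R n \<in> C \<and>
     (\<forall>c\<in>C. \<forall>d\<in>C. vec_add R n c d \<in> C) \<and>
     (\<forall>r\<in>carrier R. \<forall>c\<in>C. vec_lsmult R n r c \<in> C)"

definition k_generated_code :: "('a, 'm) ring_scheme \<Rightarrow> nat \<Rightarrow> nat \<Rightarrow> (nat \<Rightarrow> 'a) set \<Rightarrow> bool" where
  "k_generated_code R n k C \<longleftrightarrow>
     (\<exists>G. finite G \<and> card G = k \<and> G \<subseteq> C \<and> C = \<Inter>{D. left_linear_code R n D \<and> G \<subseteq> D})"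

definition row_code :: "('a, 'm) ring_scheme \<Rightarrow> nat \<Rightarrow> nat \<Rightarrow> (nat \<Rightarrow> nat \<Rightarrow> 'a) \<Rightarrow> (nat \<Rightarrow> 'a) set" where
  "row_code R m n Y = {vec_mat R m n x Y | x. x \<in> vecs R m}"

definition two_weight_code :: "('a, 'm) ring_scheme \<Rightarrow> nat \<Rightarrow> (nat \<Rightarrow> 'a) set \<Rightarrow> real \<Rightarrow> real \<Rightarrow> bool" where
  "two_weight_code R n C w1 w2 \<longleftrightarrow>
     left_linear_code R n C \<and>
     (\<forall>c\<in>C. c \<noteq> vec_zero R n \<longrightarrow> whom_vec R n c > 0) \<and>
     w1 \<noteq> w2 \<and> whom_vec R n ` C - {0} = {w1, w2}"

end

theory Submission
  imports Defs
begin

text \<open>  A point \<open>yR\<close> has a residue, the point of \<open>PG(2, q)\<close> obtained by reducing \<open>y\<close> modulo \<open>X\<close>. The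
  action of a constant matrix commutes with reduction, and the Singer cycle is transitive on
  \<open>PG(2, q)\<close>; so the \<open>q\<^sup>2 + q + 1\<close> residues of the points of \<open>K\<close> exhaust \<open>PG(2, q)\<close>, and by counting
  each point of \<open>PG(2, q)\<close> is met exactly once. Hence exactly \<open>q + 1\<close> residues lie on any given line
  (\<open>covering_points_incidence\<close>).

  The weight of a codeword \<open>xY\<close> only depends on how many coordinates \<open>x y\<^sub>j\<close> are \<open>0\<close> and how many
  lie in the radical. There are two kinds of nonzero \<open>x\<close>.

  \<^item> If all coordinates of \<open>x\<close> are in the radical, say \<open>x = bX\<close> with a vector \<open>b\<close> over the field, then
    \<open>x y\<^sub>j = (b \<cdot> \<sigma>(y\<^sub>j)) X\<close>. All coordinates are in the radical, and \<open>q + 1\<close> of them vanish because the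
    vectors \<open>\<sigma>(y\<^sub>j)\<close> again represent each point of \<open>PG(2, q)\<close> once (\<open>card_zeros_rad\<close>). The weight is
    \<open>q\<^sup>2 \<cdot> q/(q - 1)\<close>.

  \<^item> Otherwise \<open>x\<close> has a unit coordinate, and \<open>y \<mapsto> x y\<close> defines a hyperplane. The coordinate \<open>x y\<^sub>j\<close> is
    in the radical iff the residue of \<open>y\<^sub>j\<close> is on the line of the residue of \<open>x\<close>, which happens \<open>q + 1\<close>
    times; it is \<open>0\<close> iff \<open>y\<^sub>jR\<close> is on the hyperplane, which happens \<open>1\<close> or \<open>q + 1\<close> times. The weight is
    \<open>q \<cdot> q/(q - 1) + q\<^sup>2 = q\<^sup>3/(q - 1)\<close> or \<open>q\<^sup>2\<close>.

  The first weight occurs for \<open>x\<close> in the radical. The second occurs because the number of pairs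
  \<open>(x, j)\<close> with \<open>x y\<^sub>j = 0\<close> is too large for all hyperplanes to be tangent
  (\<open>exists_secant_hyperplane\<close>). As no nonzero \<open>x\<close> gives the codeword \<open>0\<close>, the rows of \<open>Y\<close> are
  distinct, and they are the three generators.

  The ring enters only through the residue map, a section of it, and the embedding \<open>b \<mapsto> bX\<close> of the
  field onto the radical; the locale \<open>chain_ring_of_length_two\<close> collects their rules.\<close>

section \<open>Skew polynomials modulo the square of the indeterminate\<close>

locale field_automorphism = field F for F (structure) +
  fixes \<sigma> :: "'a \<Rightarrow> 'a"
  assumes iso: "\<sigma> \<in> ring_iso F F"
begin

lemma hom: "\<sigma> \<in> ring_hom F F"
  using iso by (simp add: ring_iso_def)

lemma hom_funpow: "(\<sigma> ^^ i) \<in> ring_hom F F"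
proof (induction i)
  case 0
  then show ?case by (simp add: ring_hom_def)
next
  case (Suc i)
  then show ?case using ring_hom_trans[OF Suc hom] by (simp add: o_def)
qed

lemma ring_hom_cring_funpow: "ring_hom_cring F F (\<sigma> ^^ i)"
  using hom_funpow by (intro ring_hom_cringI) (auto intro!: ring_hom_ringI2 simp: ring_axioms cring_axioms is_cring)

lemma funpow_closed [simp, intro]: "a \<in> carrier F \<Longrightarrow> (\<sigma> ^^ i) a \<in> carrier F"
  using ring_hom_closed[OF hom_funpow] .

lemmas funpow_hom [simp] =
  ring_hom_add[OF hom_funpow] ring_hom_mult[OF hom_funpow] ring_hom_one[OF hom_funpow]

lemma funpow_zero [simp]: "(\<sigma> ^^ i) \<zero> = \<zero>"
  using ring_hom_cring.hom_zero[OF ring_hom_cring_funpow] .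

abbreviation P where "P \<equiv> skew_poly F \<sigma>"

lemma skew_simps:
  "carrier P = up F"
  "f \<otimes>\<^bsub>P\<^esub> g = (\<lambda>n. \<Oplus>i\<in>{..n}. f i \<otimes> (\<sigma> ^^ i) (g (n - i)))"
  "\<one>\<^bsub>P\<^esub> = (\<lambda>n. if n = 0 then \<one> else \<zero>)"
  "\<zero>\<^bsub>P\<^esub> = (\<lambda>n. \<zero>)"
  "f \<oplus>\<^bsub>P\<^esub> g = (\<lambda>n. f n \<oplus> g n)"
  by (simp_all add: skew_poly_def)

lemma up_skew_mult_closed:
  assumes "f \<in> up F" "g \<in> up F"
  shows "(\<lambda>n. \<Oplus>i\<in>{..n}. f i \<otimes> (\<sigma> ^^ i) (g (n - i))) \<in> up F"
proof
  show "(\<Oplus>i\<in>{..n}. f i \<otimes> (\<sigma> ^^ i) (g (n - i))) \<in> carrier F" for n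
    using assms by (intro finsum_closed) auto
  obtain a b where a: "bound \<zero> a f" and b: "bound \<zero> b g"
    using assms by fast
  have "bound \<zero> (a + b) (\<lambda>n. \<Oplus>i\<in>{..n}. f i \<otimes> (\<sigma> ^^ i) (g (n - i)))"
  proof
    fix m assume m: "a + b < m"
    have "f i \<otimes> (\<sigma> ^^ i) (g (m - i)) = \<zero>" for i
    proof (cases "a < i")
      case True
      then show ?thesis using bound.bound[OF a, of i] assms by (simp add: mem_upD)
    next
      case False
      then have "g (m - i) = \<zero>" using b m by (intro bound.bound[OF b]) auto
      then show ?thesis using assms by (simp add: mem_upD)
    qed
    then show "(\<Oplus>i\<in>{..m}. f i \<otimes> (\<sigma> ^^ i) (g (m - i))) = \<zero>"
      by simp
  qed
  then show "\<exists>n. bound \<zero> n (\<lambda>n. \<Oplus>i\<in>{..n}. f i \<otimes> (\<sigma> ^^ i) (g (n - i)))" ..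
qed

text \<open>  Both sides of the associativity law at coefficient \<open>n\<close> are sums over the first index \<open>j \<le> n\<close>. To
  allow an induction, the sums are cut off at \<open>j \<le> k\<close> while the index \<open>n\<close> of the coefficient stays
  fixed. The twists agree since \<open>\<sigma>\<^sup>j (b \<sigma>\<^sup>i(c)) = \<sigma>\<^sup>j(b) \<sigma>\<^sup>i\<^sup>+\<^sup>j(c)\<close>.\<close>

lemma skew_mult_assoc_aux:
  assumes R: "a \<in> UNIV \<rightarrow> carrier F" "b \<in> UNIV \<rightarrow> carrier F" "c \<in> UNIV \<rightarrow> carrier F"
    and "k \<le> n"
  shows "(\<Oplus>j\<in>{..k}. (\<Oplus>i\<in>{..j}. a i \<otimes> (\<sigma> ^^ i) (b (j - i))) \<otimes> (\<sigma> ^^ j) (c (n - j)))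
    = (\<Oplus>j\<in>{..k}. a j \<otimes> (\<sigma> ^^ j) (\<Oplus>i\<in>{..k-j}. b i \<otimes> (\<sigma> ^^ i) (c (n - j - i))))"
  using \<open>k \<le> n\<close>
proof (induction k)
  case 0
  then show ?case using R by (simp add: Pi_def m_assoc)
next
  case (Suc k)
  have a: "a i \<in> carrier F" and b: "b i \<in> carrier F" and c: "c i \<in> carrier F" for i
    using R by auto
  let ?last = "\<lambda>j. a j \<otimes> ((\<sigma> ^^ j) (b (Suc k - j)) \<otimes> (\<sigma> ^^ Suc k) (c (n - Suc k)))"
  \<comment> \<open>Passing from \<open>k\<close> to \<open>k + 1\<close> adds one summand to each inner sum, all with the same factor \<open>c\<close>.\<close>
  have term_eq: "a j \<otimes> (\<sigma> ^^ j) (\<Oplus>i\<in>{..Suc k-j}. b i \<otimes> (\<sigma> ^^ i) (c (n - j - i)))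
      = ?last j \<oplus> a j \<otimes> (\<sigma> ^^ j) (\<Oplus>i\<in>{..k-j}. b i \<otimes> (\<sigma> ^^ i) (c (n - j - i)))"
    if "j \<le> k" for j
  proof -
    have s: "Suc k - j = Suc (k - j)" and n: "n - j - Suc (k - j) = n - Suc k"
      and p: "(\<sigma> ^^ j) ((\<sigma> ^^ Suc (k - j)) x) = (\<sigma> ^^ Suc k) x" for x
      using that funpow_add[of j "Suc (k - j)" \<sigma>] by (auto simp del: funpow.simps)
    show ?thesis
      unfolding s using a b c n p
      by (simp add: Pi_def r_distr del: funpow.simps)
  qed
  have "(\<Oplus>j\<in>{..Suc k}. (\<Oplus>i\<in>{..j}. a i \<otimes> (\<sigma> ^^ i) (b (j - i))) \<otimes> (\<sigma> ^^ j) (c (n - j)))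
    = (\<Oplus>i\<in>{..Suc k}. a i \<otimes> (\<sigma> ^^ i) (b (Suc k - i))) \<otimes> (\<sigma> ^^ Suc k) (c (n - Suc k)) \<oplus>
      (\<Oplus>j\<in>{..k}. a j \<otimes> (\<sigma> ^^ j) (\<Oplus>i\<in>{..k-j}. b i \<otimes> (\<sigma> ^^ i) (c (n - j - i))))"
    using Suc a b c by (subst finsum_Suc) (auto simp del: funpow.simps finsum_Suc)
  also have "(\<Oplus>i\<in>{..Suc k}. a i \<otimes> (\<sigma> ^^ i) (b (Suc k - i))) \<otimes> (\<sigma> ^^ Suc k) (c (n - Suc k))
      = (\<Oplus>i\<in>{..Suc k}. ?last i)"
    using a b c by (subst finsum_ldistr) (auto simp: m_assoc simp del: funpow.simps finsum_Suc)
  also have "\<dots> = ?last (Suc k) \<oplus> (\<Oplus>i\<in>{..k}. ?last i)"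
    using a b c by (subst finsum_Suc) (auto simp del: funpow.simps)
  also have "?last (Suc k) \<oplus> (\<Oplus>i\<in>{..k}. ?last i) \<oplus>
        (\<Oplus>j\<in>{..k}. a j \<otimes> (\<sigma> ^^ j) (\<Oplus>i\<in>{..k-j}. b i \<otimes> (\<sigma> ^^ i) (c (n - j - i))))
      = ?last (Suc k) \<oplus> (\<Oplus>j\<in>{..k}. ?last j \<oplus>
          a j \<otimes> (\<sigma> ^^ j) (\<Oplus>i\<in>{..k-j}. b i \<otimes> (\<sigma> ^^ i) (c (n - j - i))))"
    using a b c by (subst finsum_addf) (auto simp: a_assoc Pi_def simp del: funpow.simps)
  also have "\<dots> = ?last (Suc k) \<oplus> (\<Oplus>j\<in>{..k}. a j \<otimes> (\<sigma> ^^ j) (\<Oplus>i\<in>{..Suc k-j}. b i \<otimes> (\<sigma> ^^ i) (c (n - j - i))))"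
    using a b c term_eq
    by (intro arg_cong2[where f = "(\<oplus>)"] finsum_cong') (auto simp: Pi_def simp del: funpow.simps)
  also have "\<dots> = (\<Oplus>j\<in>{..Suc k}. a j \<otimes> (\<sigma> ^^ j) (\<Oplus>i\<in>{..Suc k-j}. b i \<otimes> (\<sigma> ^^ i) (c (n - j - i))))"
    using a b c by (subst finsum_Suc) (auto simp: Pi_def simp del: funpow.simps)
  finally show ?case .
qed

lemma skew_poly_ring: "ring P"
proof (rule ringI)
  show "abelian_group P"
  proof (rule abelian_groupI)
    fix f assume f: "f \<in> carrier P"
    show "\<exists>g\<in>carrier P. g \<oplus>\<^bsub>P\<^esub> f = \<zero>\<^bsub>P\<^esub>"
      using f by (intro bexI[of _ "\<lambda>n. \<ominus> f n"]) (auto simp: skew_simps l_neg mem_upD up_a_inv_closed)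
  qed (auto simp: skew_simps up_add_closed fun_eq_iff a_assoc mem_upD intro: a_comm)
  show "Group.monoid P"
  proof (rule monoidI)
    fix f g h assume A: "f \<in> carrier P" "g \<in> carrier P" "h \<in> carrier P"
    then show "f \<otimes>\<^bsub>P\<^esub> g \<otimes>\<^bsub>P\<^esub> h = f \<otimes>\<^bsub>P\<^esub> (g \<otimes>\<^bsub>P\<^esub> h)"
      unfolding skew_simps by (intro ext skew_mult_assoc_aux) (auto simp: mem_upD)
  next
    show "\<one>\<^bsub>P\<^esub> \<in> carrier P" by (simp add: skew_simps up_one_closed)
  next
    fix f assume f: "f \<in> carrier P"
    show "\<one>\<^bsub>P\<^esub> \<otimes>\<^bsub>P\<^esub> f = f"
    proof
      fix n
      have "(\<Oplus>i\<in>{..n}. (if i = 0 then \<one> else \<zero>) \<otimes> (\<sigma> ^^ i) (f (n - i)))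
          = (\<Oplus>i\<in>{..n}. if 0 = i then f (n - i) else \<zero>)"
        using f by (intro finsum_cong') (auto simp: skew_simps mem_upD)
      also have "\<dots> = f n"
        using f finsum_singleton[of 0 "{..n}" "\<lambda>i. f (n - i)"] by (auto simp: skew_simps mem_upD)
      finally show "(\<one>\<^bsub>P\<^esub> \<otimes>\<^bsub>P\<^esub> f) n = f n" by (simp add: skew_simps)
    qed
    show "f \<otimes>\<^bsub>P\<^esub> \<one>\<^bsub>P\<^esub> = f"
    proof
      fix n
      have "(\<Oplus>i\<in>{..n}. f i \<otimes> (\<sigma> ^^ i) (if n - i = 0 then \<one> else \<zero>))
          = (\<Oplus>i\<in>{..n}. if n = i then f i else \<zero>)"
        using f by (intro finsum_cong') (auto simp: skew_simps mem_upD)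
      also have "\<dots> = f n"
        using f finsum_singleton[of n "{..n}" f] by (auto simp: skew_simps mem_upD)
      finally show "(f \<otimes>\<^bsub>P\<^esub> \<one>\<^bsub>P\<^esub>) n = f n" by (simp add: skew_simps)
    qed
  qed (auto simp: skew_simps up_skew_mult_closed)
next
  fix f g h assume A: "f \<in> carrier P" "g \<in> carrier P" "h \<in> carrier P"
  then have c: "f i \<in> carrier F" "g i \<in> carrier F" "h i \<in> carrier F" for i
    by (auto simp: skew_simps mem_upD)
  show "(f \<oplus>\<^bsub>P\<^esub> g) \<otimes>\<^bsub>P\<^esub> h = f \<otimes>\<^bsub>P\<^esub> h \<oplus>\<^bsub>P\<^esub> g \<otimes>\<^bsub>P\<^esub> h"
    using c by (simp add: skew_simps l_distr finsum_addf Pi_def)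
  show "h \<otimes>\<^bsub>P\<^esub> (f \<oplus>\<^bsub>P\<^esub> g) = h \<otimes>\<^bsub>P\<^esub> f \<oplus>\<^bsub>P\<^esub> h \<otimes>\<^bsub>P\<^esub> g"
    using c by (simp add: skew_simps r_distr finsum_addf Pi_def)
qed

lemma coeff_mult_0: "f \<in> up F \<Longrightarrow> g \<in> up F \<Longrightarrow> (f \<otimes>\<^bsub>P\<^esub> g) 0 = f 0 \<otimes> g 0"
  by (simp add: skew_simps mem_upD)

lemma coeff_mult_1: "f \<in> up F \<Longrightarrow> g \<in> up F \<Longrightarrow>
    (f \<otimes>\<^bsub>P\<^esub> g) 1 = f 0 \<otimes> g 1 \<oplus> f 1 \<otimes> \<sigma> (g 0)"
  using ring_hom_closed[OF hom]
  by (simp add: skew_simps mem_upD a_comm)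

lemma mult_X_power2:
  assumes "f \<in> up F"
  shows "(skew_X F [^]\<^bsub>P\<^esub> (2::nat)) = (\<lambda>n. if n = 2 then \<one> else \<zero>)" (is ?A)
    and "f \<otimes>\<^bsub>P\<^esub> (skew_X F [^]\<^bsub>P\<^esub> (2::nat)) = (\<lambda>n. if n < 2 then \<zero> else f (n - 2))" (is ?B)
proof -
  have mon: "(\<lambda>n. if n = m then \<one> else \<zero>) \<in> up F" for m :: nat
    by (rule mem_upI) (auto intro!: exI[of _ m] bound.intro)
  have shift: "g \<otimes>\<^bsub>P\<^esub> (\<lambda>n. if n = m then \<one> else \<zero>) = (\<lambda>n. if n < m then \<zero> else g (n - m))"
    if g: "g \<in> up F" for g and m :: nat
  proof
    fix n
    have "(\<Oplus>i\<in>{..n}. g i \<otimes> (\<sigma> ^^ i) (if n - i = m then \<one> else \<zero>))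
        = (\<Oplus>i\<in>{..n}. if n - i = m then g i else \<zero>)"
      using g by (intro finsum_cong') (auto simp: mem_upD)
    also have "\<dots> = (if n < m then \<zero> else g (n - m))"
    proof (cases "n < m")
      case True
      then have "(\<Oplus>i\<in>{..n}. if n - i = m then g i else \<zero>) = (\<Oplus>i\<in>{..n}. \<zero>)"
        by (intro finsum_cong') auto
      then show ?thesis using True by simp
    next
      case False
      then have "(\<Oplus>i\<in>{..n}. if n - i = m then g i else \<zero>) = (\<Oplus>i\<in>{..n}. if n - m = i then g i else \<zero>)"
        using g by (intro finsum_cong') (auto simp: mem_upD)
      then show ?thesis
        using False g finsum_singleton[of "n - m" "{..n}" g] by (auto simp: mem_upD)
    qed
    finally show "(g \<otimes>\<^bsub>P\<^esub> (\<lambda>n. if n = m then \<one> else \<zero>)) n = (if n < m then \<zero> else g (n - m))"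
      by (simp add: skew_simps)
  qed
  interpret P: ring P by (rule skew_poly_ring)
  have X: "skew_X F \<in> carrier P"
    using mon[of 1] by (simp add: skew_X_def skew_simps)
  have "(skew_X F [^]\<^bsub>P\<^esub> (2::nat)) = skew_X F \<otimes>\<^bsub>P\<^esub> skew_X F"
    using X by (simp add: numeral_2_eq_2)
  also have "\<dots> = (\<lambda>n. if n < 1 then \<zero> else skew_X F (n - 1))"
    using shift[of "skew_X F" 1] X unfolding skew_X_def by (simp add: skew_simps)
  also have "\<dots> = (\<lambda>n. if n = 2 then \<one> else \<zero>)"
    by (auto simp: skew_X_def fun_eq_iff)
  finally show ?A .
  then show ?B using shift[OF assms, of 2] by simp
qed


text \<open>  The generator \<open>X\<^sup>2\<close> stands on the right of its coefficients, so multiplying a shifted sequence by it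
  from the right involves no twist and gives back the original sequence; thus even the left ideal
  generated by \<open>X\<^sup>2\<close> contains all polynomials without constant and linear term.\<close>

lemma X2_ideal_eq: "X2_ideal F \<sigma> = {f \<in> up F. f 0 = \<zero> \<and> f 1 = \<zero>}" (is "_ = ?I")
  and ideal_X2: "ideal (X2_ideal F \<sigma>) P"
proof -
  interpret P: ring P by (rule skew_poly_ring)
  let ?X2 = "skew_X F [^]\<^bsub>P\<^esub> (2::nat)"
  have X2: "?X2 = (\<lambda>n. if n = 2 then \<one> else \<zero>)" by (rule mult_X_power2(1)[OF up_one_closed])
  have X2_in: "?X2 \<in> up F" unfolding X2
    by (rule mem_upI) (auto intro!: exI[of _ 2] bound.intro)
  have I: "ideal ?I P"
  proof (rule idealI[OF skew_poly_ring])
    show "subgroup ?I (add_monoid P)"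
    proof (rule group.subgroupI)
      show "group (add_monoid P)" by (rule P.a_group)
      show "?I \<subseteq> carrier (add_monoid P)" by (auto simp: skew_simps)
      show "?I \<noteq> {}" using P.zero_closed unfolding skew_simps by blast
    next
      fix f assume f: "f \<in> ?I"
      have "inv\<^bsub>add_monoid P\<^esub> f = \<ominus>\<^bsub>P\<^esub> f" by (simp add: a_inv_def)
      also have "\<dots> = (\<lambda>n. \<ominus> f n)"
        by (rule P.minus_equality) (use f in \<open>auto simp: skew_simps l_neg mem_upD up_a_inv_closed\<close>)
      finally show "inv\<^bsub>add_monoid P\<^esub> f \<in> ?I" using f up_a_inv_closed by simp
    next
      fix f g assume "f \<in> ?I" "g \<in> ?I"
      then show "f \<otimes>\<^bsub>add_monoid P\<^esub> g \<in> ?I" using up_add_closed[of f g] by (simp add: skew_simps)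
    qed
  next
    fix f g assume A: "f \<in> ?I" "g \<in> carrier P"
    then have c: "g \<in> up F" "f \<in> up F" "g 0 \<in> carrier F" "g 1 \<in> carrier F" "f 0 = \<zero>" "f 1 = \<zero>"
      by (auto simp: skew_simps mem_upD)
    then have s: "\<sigma> (g 0) \<in> carrier F" "\<sigma> \<zero> = \<zero>"
      using ring_hom_closed[OF hom] funpow_zero[of 1] by simp_all
    have m: "g \<otimes>\<^bsub>P\<^esub> f \<in> up F" "f \<otimes>\<^bsub>P\<^esub> g \<in> up F"
      using c P.m_closed by (auto simp: skew_simps(1))
    show "g \<otimes>\<^bsub>P\<^esub> f \<in> ?I" "f \<otimes>\<^bsub>P\<^esub> g \<in> ?I"
      using c s m by (simp_all add: coeff_mult_0 coeff_mult_1[simplified])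
  qed
  have X2_I: "?X2 \<in> ?I"
    using X2_in unfolding X2 by simp
  have "X2_ideal F \<sigma> \<subseteq> ?I" unfolding X2_ideal_def
    by (rule P.genideal_minimal[OF I]) (use X2_I in blast)
  moreover have "?I \<subseteq> X2_ideal F \<sigma>"
  proof
    fix f assume f: "f \<in> ?I"
    let ?g = "\<lambda>n. f (n + 2)"
    have g: "?g \<in> up F"
    proof (rule mem_upI)
      show "f (n + 2) \<in> carrier F" for n using f by (simp add: mem_upD)
      obtain b where "bound \<zero> b f" using f bound_upD by blast
      then have "bound \<zero> b ?g" by (simp add: bound_def)
      then show "\<exists>n. bound \<zero> n ?g" ..
    qed
    have "f = ?g \<otimes>\<^bsub>P\<^esub> ?X2" unfolding mult_X_power2(2)[OF g]
    proof
      fix n show "f n = (if n < 2 then \<zero> else f (n - 2 + 2))"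
        using f le_add_diff_inverse2[of 2 n] by (cases "n < 2") (auto simp: less_2_cases_iff)
    qed
    moreover have "?X2 \<in> carrier P" using X2_in by (simp only: skew_simps(1))
    then have "ideal (X2_ideal F \<sigma>) P" "?X2 \<in> X2_ideal F \<sigma>" unfolding X2_ideal_def
      by (auto intro!: P.genideal_ideal P.genideal_self' simp del: P.nat_pow_Suc)
    ultimately show "f \<in> X2_ideal F \<sigma>"
      using ideal.I_l_closed[of "X2_ideal F \<sigma>" P ?X2 ?g] g by (simp only: skew_simps(1))
  qed
  ultimately show "X2_ideal F \<sigma> = ?I" by blast
  then show "ideal (X2_ideal F \<sigma>) P" using I by simp
qed

lemma sigma_closed [simp, intro]: "a \<in> carrier F \<Longrightarrow> \<sigma> a \<in> carrier F"
  using ring_hom_closed[OF hom] .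

lemma sigma_zero [simp]: "\<sigma> \<zero> = \<zero>"
  using funpow_zero[of 1] by simp

definition coset :: "(nat \<Rightarrow> 'a) \<Rightarrow> (nat \<Rightarrow> 'a) set" where
  "coset f = X2_ideal F \<sigma> +>\<^bsub>P\<^esub> f"

definition monomial :: "nat \<Rightarrow> 'a \<Rightarrow> nat \<Rightarrow> 'a" where
  "monomial k a = (\<lambda>n. if n = k then a else \<zero>)"

text \<open>  All representatives of a coset have the same constant term, so the choice is immaterial.\<close>

definition residue :: "(nat \<Rightarrow> 'a) set \<Rightarrow> 'a" where
  "residue c = (SOME f. f \<in> c) 0"

definition linear_part :: "'a \<Rightarrow> (nat \<Rightarrow> 'a) set" where
  "linear_part b = coset (monomial 1 b)"

lemma monomial_up [simp, intro]: "a \<in> carrier F \<Longrightarrow> monomial k a \<in> up F"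
  unfolding monomial_def by (rule mem_upI) (auto intro!: exI[of _ k] bound.intro)

lemma monomial_apply [simp]: "monomial k a n = (if n = k then a else \<zero>)"
  by (simp add: monomial_def)

lemma const_embed_eq: "const_embed F \<sigma> a = coset (monomial 0 a)"
  by (simp add: const_embed_def coset_def monomial_def)

lemma mem_coset_iff:
  assumes "f \<in> up F"
  shows "g \<in> coset f \<longleftrightarrow> g \<in> up F \<and> g 0 = f 0 \<and> g 1 = f 1"
proof
  assume "g \<in> coset f"
  then obtain h where "h \<in> X2_ideal F \<sigma>" "g = h \<oplus>\<^bsub>P\<^esub> f"
    by (auto simp: coset_def a_r_coset_def')
  then show "g \<in> up F \<and> g 0 = f 0 \<and> g 1 = f 1"
    using assms up_add_closed[of h f] by (simp add: X2_ideal_eq skew_simps mem_upD)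
next
  assume g: "g \<in> up F \<and> g 0 = f 0 \<and> g 1 = f 1"
  let ?h = "\<lambda>n. g n \<ominus> f n"
  have "?h \<in> X2_ideal F \<sigma>"
    using g assms up_minus_closed[of g f] by (simp add: X2_ideal_eq mem_upD r_neg a_minus_def)
  moreover have "g = ?h \<oplus>\<^bsub>P\<^esub> f"
    using g assms by (simp add: fun_eq_iff skew_simps a_minus_def a_assoc l_neg mem_upD)
  ultimately show "g \<in> coset f"
    by (auto simp: coset_def a_r_coset_def')
qed

lemma coset_eq_iff:
  assumes "f \<in> up F" "g \<in> up F"
  shows "coset f = coset g \<longleftrightarrow> f 0 = g 0 \<and> f 1 = g 1"
  using assms mem_coset_iff[OF assms(1)] mem_coset_iff[OF assms(2)] by (auto simp: set_eq_iff)

lemma residue_coset: "f \<in> up F \<Longrightarrow> residue (coset f) = f 0"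
  unfolding residue_def using mem_coset_iff[of f]
  by (metis (mono_tags, lifting) someI)

end

text \<open>  Here \<open>\<pi>\<close> is the reduction modulo the radical, \<open>\<iota>\<close> a section of it and \<open>\<tau> b\<close> stands for \<open>bX\<close>. The
  rules for products with \<open>\<tau> b\<close> are \<open>r (bX) = (\<pi>(r) b) X\<close> and \<open>(bX) r = (b \<sigma>(\<pi>(r))) X\<close>.\<close>

locale chain_ring_of_length_two = R: ring R + F: field F
  for R :: "('b, 'n) ring_scheme" (structure) and F :: "('a, 'm) ring_scheme" +
  fixes \<sigma> :: "'a \<Rightarrow> 'a" and \<pi> :: "'b \<Rightarrow> 'a" and \<iota> \<tau> :: "'a \<Rightarrow> 'b"
  assumes finite_F: "finite (carrier F)"
    and sigma_iso: "\<sigma> \<in> ring_iso F F"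
    and residue_hom: "\<pi> \<in> ring_hom R F"
    and lift_closed [simp, intro]: "a \<in> carrier F \<Longrightarrow> \<iota> a \<in> carrier R"
    and residue_lift [simp]: "a \<in> carrier F \<Longrightarrow> \<pi> (\<iota> a) = a"
    and rad_closed [simp, intro]: "a \<in> carrier F \<Longrightarrow> \<tau> a \<in> carrier R"
    and rad_add: "a \<in> carrier F \<Longrightarrow> b \<in> carrier F \<Longrightarrow> \<tau> (a \<oplus>\<^bsub>F\<^esub> b) = \<tau> a \<oplus> \<tau> b"
    and rad_inj: "inj_on \<tau> (carrier F)"
    and rad_eq: "\<tau> ` carrier F = {r \<in> carrier R. \<pi> r = \<zero>\<^bsub>F\<^esub>}"
    and mult_rad: "r \<in> carrier R \<Longrightarrow> a \<in> carrier F \<Longrightarrow> r \<otimes> \<tau> a = \<tau> (\<pi> r \<otimes>\<^bsub>F\<^esub> a)"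
    and rad_mult: "r \<in> carrier R \<Longrightarrow> a \<in> carrier F \<Longrightarrow> \<tau> a \<otimes> r = \<tau> (a \<otimes>\<^bsub>F\<^esub> \<sigma> (\<pi> r))"

lemma (in field_automorphism) chain_ring_skew_chain_ring:
  assumes "finite (carrier F)"
  shows "chain_ring_of_length_two (skew_chain_ring F \<sigma>) F \<sigma> residue (const_embed F \<sigma>) linear_part"
proof -
  interpret I: ideal "X2_ideal F \<sigma>" P by (rule ideal_X2)
  let ?R = "skew_chain_ring F \<sigma>"
  have ring: "ring ?R" unfolding skew_chain_ring_def by (rule I.quotient_is_ring)
  interpret coset: ring_hom_ring P ?R coset
    using I.rcos_ring_hom_ring by (simp add: skew_chain_ring_def coset_def[abs_def])
  have carrier: "carrier ?R = coset ` up F"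
    by (auto simp: skew_chain_ring_def FactRing_def A_RCOSETS_def' coset_def skew_simps(1))
  have up: "f \<in> carrier P \<longleftrightarrow> f \<in> up F" for f by (simp only: skew_simps(1))
  have add: "coset (f \<oplus>\<^bsub>P\<^esub> g) = coset f \<oplus>\<^bsub>?R\<^esub> coset g"
    and mult: "coset (f \<otimes>\<^bsub>P\<^esub> g) = coset f \<otimes>\<^bsub>?R\<^esub> coset g"
    and closed: "f \<oplus>\<^bsub>P\<^esub> g \<in> up F" "f \<otimes>\<^bsub>P\<^esub> g \<in> up F"
    if "f \<in> up F" "g \<in> up F" for f g
    using that coset.hom_add coset.hom_mult I.a_closed I.m_closed by (simp_all only: up)
  have one: "coset \<one>\<^bsub>P\<^esub> = \<one>\<^bsub>?R\<^esub>" by (rule coset.hom_one)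
  have res: "residue \<in> ring_hom ?R F"
  proof (rule ring_hom_memI)
    fix x y assume "x \<in> carrier ?R" "y \<in> carrier ?R"
    then obtain f g where f: "f \<in> up F" "x = coset f" and g: "g \<in> up F" "y = coset g"
      by (auto simp: carrier)
    show "residue x \<in> carrier F" using f by (simp add: residue_coset mem_upD)
    show "residue (x \<otimes>\<^bsub>?R\<^esub> y) = residue x \<otimes> residue y"
      using f g by (simp add: residue_coset closed coeff_mult_0 flip: mult)
    show "residue (x \<oplus>\<^bsub>?R\<^esub> y) = residue x \<oplus> residue y"
      using f g by (simp add: residue_coset closed flip: add) (simp add: skew_simps)
  next
    show "residue \<one>\<^bsub>?R\<^esub> = \<one>"
      using up_one_closed by (simp add: residue_coset skew_simps flip: one)
  qed
  show ?thesis
  proof (intro chain_ring_of_length_two.intro chain_ring_of_length_two_axioms.intro ring res iso assms)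
    show "field F" by (rule field_axioms)
    fix a b assume a: "a \<in> carrier F"
    show "const_embed F \<sigma> a \<in> carrier ?R" "linear_part a \<in> carrier ?R"
      "residue (const_embed F \<sigma> a) = a"
      using a by (auto simp: const_embed_eq linear_part_def carrier residue_coset)
    show "linear_part (a \<oplus> b) = linear_part a \<oplus>\<^bsub>?R\<^esub> linear_part b" if b: "b \<in> carrier F"
    proof -
      have "monomial 1 (a \<oplus> b) = monomial 1 a \<oplus>\<^bsub>P\<^esub> monomial 1 b"
        using a b by (simp add: skew_simps fun_eq_iff)
      then show ?thesis using a b add by (simp add: linear_part_def)
    qed
    fix r assume "r \<in> carrier ?R"
    then obtain f where f: "f \<in> up F" "r = coset f" by (auto simp: carrier)
    show "r \<otimes>\<^bsub>?R\<^esub> linear_part a = linear_part (residue r \<otimes> a)"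
      using f a unfolding linear_part_def
      by (auto simp: residue_coset coset_eq_iff closed coeff_mult_0 coeff_mult_1[simplified] mem_upD simp flip: mult)
    show "linear_part a \<otimes>\<^bsub>?R\<^esub> r = linear_part (a \<otimes> \<sigma> (residue r))"
      using f a unfolding linear_part_def
      by (auto simp: residue_coset coset_eq_iff closed coeff_mult_0 coeff_mult_1[simplified] mem_upD simp flip: mult)
  next
    show "inj_on linear_part (carrier F)"
      by (rule inj_onI) (auto simp: linear_part_def coset_eq_iff)
    show "linear_part ` carrier F = {r \<in> carrier ?R. residue r = \<zero>}"
    proof (intro equalityI subsetI)
      fix r assume "r \<in> {r \<in> carrier ?R. residue r = \<zero>}"
      then obtain f where f: "f \<in> up F" "r = coset f" "f 0 = \<zero>"
        by (auto simp: carrier residue_coset)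
      then have "r = linear_part (f 1)"
        by (simp add: linear_part_def coset_eq_iff mem_upD)
      then show "r \<in> linear_part ` carrier F" using f by (auto simp: mem_upD)
    qed (auto simp: linear_part_def carrier residue_coset)
  qed
qed

section \<open>Vectors over a ring\<close>

text \<open>  The left factor is the row vector: the map is left linear in \<open>x\<close> and right linear in \<open>y\<close>.\<close>

definition dot :: "('a, 'm) ring_scheme \<Rightarrow> nat \<Rightarrow> (nat \<Rightarrow> 'a) \<Rightarrow> (nat \<Rightarrow> 'a) \<Rightarrow> 'a" where
  "dot R n x y = (\<Oplus>\<^bsub>R\<^esub>i\<in>{..<n}. x i \<otimes>\<^bsub>R\<^esub> y i)"

lemma vecs_apply [simp, intro]: "x \<in> vecs R n \<Longrightarrow> i < n \<Longrightarrow> x i \<in> carrier R"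
  by (auto simp: vecs_def)

lemma vecs_eqI: "x \<in> vecs R n \<Longrightarrow> y \<in> vecs R n \<Longrightarrow> (\<And>i. i < n \<Longrightarrow> x i = y i) \<Longrightarrow> x = y"
  unfolding vecs_def by (rule PiE_ext) auto

lemma restrict_vecs [intro]: "(\<And>i. i < n \<Longrightarrow> f i \<in> carrier R) \<Longrightarrow> restrict f {..<n} \<in> vecs R n"
  by (auto simp: vecs_def)

lemma finite_vecs: "finite (carrier R) \<Longrightarrow> finite (vecs R n)"
  by (simp add: vecs_def finite_PiE)

lemma card_vecs: "card (vecs R n) = card (carrier R) ^ n"
  by (simp add: vecs_def card_funcsetE)

context ring
begin

lemma vec_add_closed [simp, intro]: "x \<in> vecs R n \<Longrightarrow> y \<in> vecs R n \<Longrightarrow> vec_add R n x y \<in> vecs R n"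
  by (auto simp: vec_add_def)

lemma vec_zero_closed [simp, intro]: "vec_zero R n \<in> vecs R n"
  by (auto simp: vec_zero_def)

lemma vec_lsmult_closed [simp, intro]: "r \<in> carrier R \<Longrightarrow> x \<in> vecs R n \<Longrightarrow> vec_lsmult R n r x \<in> vecs R n"
  by (auto simp: vec_lsmult_def)

lemma vec_rsmult_closed [simp, intro]: "r \<in> carrier R \<Longrightarrow> x \<in> vecs R n \<Longrightarrow> vec_rsmult R n x r \<in> vecs R n"
  by (auto simp: vec_rsmult_def)

lemma vec_rsmult_one: "x \<in> vecs R n \<Longrightarrow> vec_rsmult R n x \<one> = x"
  by (rule vecs_eqI[of _ R n]) (auto simp: vec_rsmult_def)

lemma vec_rsmult_assoc:
  "x \<in> vecs R n \<Longrightarrow> r \<in> carrier R \<Longrightarrow> s \<in> carrier R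
    \<Longrightarrow> vec_rsmult R n (vec_rsmult R n x r) s = vec_rsmult R n x (r \<otimes> s)"
  by (rule vecs_eqI[of _ R n]) (auto simp: vec_rsmult_def m_assoc)

lemma vec_nonzero_iff: "x \<in> vecs R n \<Longrightarrow> x \<noteq> vec_zero R n \<longleftrightarrow> (\<exists>i<n. x i \<noteq> \<zero>)"
  using vecs_eqI[of x R n "vec_zero R n"] by (auto simp: vec_zero_def)

lemma dot_closed [simp, intro]: "x \<in> vecs R n \<Longrightarrow> y \<in> vecs R n \<Longrightarrow> dot R n x y \<in> carrier R"
  unfolding dot_def by (rule finsum_closed) auto

lemma dot_add_left:
  assumes "x \<in> vecs R n" "x' \<in> vecs R n" "y \<in> vecs R n"
  shows "dot R n (vec_add R n x x') y = dot R n x y \<oplus> dot R n x' y"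
proof -
  have "dot R n (vec_add R n x x') y = (\<Oplus>i\<in>{..<n}. x i \<otimes> y i \<oplus> x' i \<otimes> y i)"
    unfolding dot_def using assms by (intro finsum_cong') (auto simp: vec_add_def l_distr)
  also have "\<dots> = dot R n x y \<oplus> dot R n x' y"
    unfolding dot_def using assms by (intro finsum_addf) auto
  finally show ?thesis .
qed

lemma dot_add_right:
  assumes "x \<in> vecs R n" "y \<in> vecs R n" "y' \<in> vecs R n"
  shows "dot R n x (vec_add R n y y') = dot R n x y \<oplus> dot R n x y'"
proof -
  have "dot R n x (vec_add R n y y') = (\<Oplus>i\<in>{..<n}. x i \<otimes> y i \<oplus> x i \<otimes> y' i)"
    unfolding dot_def using assms by (intro finsum_cong') (auto simp: vec_add_def r_distr)
  also have "\<dots> = dot R n x y \<oplus> dot R n x y'"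
    unfolding dot_def using assms by (intro finsum_addf) auto
  finally show ?thesis .
qed

lemma dot_lsmult:
  assumes "r \<in> carrier R" "x \<in> vecs R n" "y \<in> vecs R n"
  shows "dot R n (vec_lsmult R n r x) y = r \<otimes> dot R n x y"
proof -
  have "dot R n (vec_lsmult R n r x) y = (\<Oplus>i\<in>{..<n}. r \<otimes> (x i \<otimes> y i))"
    unfolding dot_def using assms by (intro finsum_cong') (auto simp: vec_lsmult_def m_assoc)
  also have "\<dots> = r \<otimes> dot R n x y"
    unfolding dot_def using assms by (intro finsum_rdistr[symmetric]) auto
  finally show ?thesis .
qed

lemma dot_rsmult:
  assumes "r \<in> carrier R" "x \<in> vecs R n" "y \<in> vecs R n"
  shows "dot R n x (vec_rsmult R n y r) = dot R n x y \<otimes> r"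
proof -
  have "dot R n x (vec_rsmult R n y r) = (\<Oplus>i\<in>{..<n}. x i \<otimes> y i \<otimes> r)"
    unfolding dot_def using assms by (intro finsum_cong') (auto simp: vec_rsmult_def m_assoc)
  also have "\<dots> = dot R n x y \<otimes> r"
    unfolding dot_def using assms by (intro finsum_ldistr[symmetric]) auto
  finally show ?thesis .
qed

lemma dot_zero_left: "y \<in> vecs R n \<Longrightarrow> dot R n (vec_zero R n) y = \<zero>"
  unfolding dot_def using finsum_cong'[of "{..<n}" "{..<n}" "\<lambda>i. \<zero>" "\<lambda>i. vec_zero R n i \<otimes> y i"]
  by (auto simp: vec_zero_def)

definition coord_vec :: "nat \<Rightarrow> nat \<Rightarrow> 'a \<Rightarrow> nat \<Rightarrow> 'a" where
  "coord_vec n i a = (\<lambda>k\<in>{..<n}. if k = i then a else \<zero>)"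

lemma coord_vec_closed [simp, intro]: "a \<in> carrier R \<Longrightarrow> coord_vec n i a \<in> vecs R n"
  by (auto simp: coord_vec_def)

lemma dot_coord_left:
  assumes "y \<in> vecs R n" "i < n" "a \<in> carrier R"
  shows "dot R n (coord_vec n i a) y = a \<otimes> y i"
proof -
  have "dot R n (coord_vec n i a) y = (\<Oplus>k\<in>{..<n}. if i = k then a \<otimes> y k else \<zero>)"
    unfolding dot_def using assms by (intro finsum_cong') (auto simp: coord_vec_def)
  also have "\<dots> = a \<otimes> y i"
    using assms by (intro finsum_singleton) auto
  finally show ?thesis .
qed

lemma dot_coord_right:
  assumes "x \<in> vecs R n" "i < n" "a \<in> carrier R"
  shows "dot R n x (coord_vec n i a) = x i \<otimes> a"
proof -
  have "dot R n x (coord_vec n i a) = (\<Oplus>k\<in>{..<n}. if i = k then x k \<otimes> a else \<zero>)"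
    unfolding dot_def using assms by (intro finsum_cong') (auto simp: coord_vec_def)
  also have "\<dots> = x i \<otimes> a"
    using assms by (intro finsum_singleton) auto
  finally show ?thesis .
qed

text \<open>  Since \<open>x \<mapsto> x \<cdot> y\<close> maps \<open>u\<close> to \<open>1\<close>, the free left module splits as the annihilator of \<open>y\<close> plus the
  free submodule generated by \<open>u\<close>.\<close>

lemma card_annihilator:
  assumes "finite (carrier R)" and u: "u \<in> vecs R n" and y: "y \<in> vecs R n" and uy: "dot R n u y = \<one>"
  shows "card {x \<in> vecs R n. dot R n x y = \<zero>} * card (carrier R) = card (carrier R) ^ n"
proof -
  let ?K = "{x \<in> vecs R n. dot R n x y = \<zero>}"
  let ?f = "\<lambda>(k, a). vec_add R n k (vec_lsmult R n a u)"
  have f_dot: "dot R n (?f (k, a)) y = a" if "k \<in> ?K" "a \<in> carrier R" for k a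
    using that u y uy by (simp add: dot_add_left dot_lsmult)
  have "bij_betw ?f (?K \<times> carrier R) (vecs R n)"
  proof (rule bij_betw_imageI)
    show "inj_on ?f (?K \<times> carrier R)"
    proof (rule inj_onI)
      fix p p' assume p: "p \<in> ?K \<times> carrier R" "p' \<in> ?K \<times> carrier R" and eq: "?f p = ?f p'"
      obtain k a k' a' where pp: "p = (k, a)" "p' = (k', a')" by (metis surj_pair)
      have a: "a' = a" using f_dot[of k a] f_dot[of k' a'] p eq by (auto simp: pp)
      have "k i = k' i" if "i < n" for i
      proof -
        have "?f p i = ?f p' i" using eq by simp
        then have "k i \<oplus> a \<otimes> u i = k' i \<oplus> a \<otimes> u i"
          using that by (simp add: pp a vec_add_def vec_lsmult_def)
        moreover have "k i \<in> carrier R" "k' i \<in> carrier R" "a \<otimes> u i \<in> carrier R"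
          using p that u by (auto simp: pp)
        ultimately show ?thesis using add.right_cancel by blast
      qed
      then show "p = p'" using p vecs_eqI[of k R n k'] by (auto simp: pp a)
    qed
    show "?f ` (?K \<times> carrier R) = vecs R n"
    proof (intro equalityI subsetI)
      fix x assume x: "x \<in> vecs R n"
      let ?a = "dot R n x y"
      let ?k = "vec_add R n x (vec_lsmult R n (\<ominus> ?a) u)"
      have "?k \<in> ?K" using x u y uy by (simp add: dot_add_left dot_lsmult r_neg)
      moreover have "x = ?f (?k, ?a)"
      proof (rule vecs_eqI[OF x])
        show "?f (?k, ?a) \<in> vecs R n" using x u y by simp
        fix i assume "i < n"
        then show "x i = ?f (?k, ?a) i"
          using x u y by (simp add: vec_add_def vec_lsmult_def a_assoc l_minus l_neg)
      qed
      ultimately show "x \<in> ?f ` (?K \<times> carrier R)" using x y by (intro image_eqI[of _ _ "(?k, ?a)"]) auto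
    qed (use u in auto)
  qed
  from bij_betw_same_card[OF this] show ?thesis
    by (simp add: card_cartesian_product card_vecs)
qed

end

lemma (in cring) dot_commute: "x \<in> vecs R n \<Longrightarrow> y \<in> vecs R n \<Longrightarrow> dot R n x y = dot R n y x"
  unfolding dot_def by (rule finsum_cong') (auto simp: m_comm)

lemma (in field) card_carrier_ge_2: "finite (carrier R) \<Longrightarrow> 2 \<le> card (carrier R)"
  using card_mono[of "carrier R" "{\<zero>, \<one>}"] by simp

text \<open>  The multiples \<open>z\<^sub>j c\<close> with \<open>c \<noteq> 0\<close> are \<open>(q - 1) (q\<^sup>2 + q + 1) = q\<^sup>3 - 1\<close> in number and reach all
  \<open>q\<^sup>3 - 1\<close> nonzero vectors. So they reach each of them once and never the zero vector. Counting the
  nonzero vectors on the line \<open>b \<cdot> v = 0\<close> in two ways gives \<open>q\<^sup>2 - 1 = (q - 1) N\<close> for the number \<open>N\<close>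
  of points \<open>z\<^sub>j\<close> on it.\<close>

lemma (in field) covering_points_incidence:
  assumes fin: "finite (carrier R)" and q: "q = card (carrier R)" and n: "n = q ^ 2 + q + 1"
    and z: "\<And>j. j < n \<Longrightarrow> z j \<in> vecs R 3"
    and cover: "\<And>v. v \<in> vecs R 3 \<Longrightarrow> v \<noteq> vec_zero R 3
      \<Longrightarrow> \<exists>j<n. \<exists>c\<in>carrier R - {\<zero>}. v = vec_rsmult R 3 (z j) c"
  shows "j < n \<Longrightarrow> z j \<noteq> vec_zero R 3"
    and "b \<in> vecs R 3 \<Longrightarrow> b \<noteq> vec_zero R 3 \<Longrightarrow> card {j. j < n \<and> dot R 3 b (z j) = \<zero>} = q + 1"
proof -
  let ?U = "carrier R - {\<zero>}"
  let ?D = "?U \<times> {..<n}"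
  let ?V = "vecs R 3 - {vec_zero R 3}"
  let ?f = "\<lambda>(c, j). vec_rsmult R 3 (z j) c"
  have q2: "2 \<le> q" using card_carrier_ge_2 fin q by simp
  have cU: "card ?U = q - 1" using fin q by simp
  have "(q - 1) * n + 1 = q ^ 3"
    using q2 unfolding n by (cases q) (simp_all add: algebra_simps power2_eq_square power3_eq_cube)
  then have cD: "card ?D = q ^ 3 - 1" using cU by (simp add: card_cartesian_product)
  have cV: "card ?V = q ^ 3 - 1" using fin q by (simp add: card_Diff_singleton card_vecs finite_vecs)
  have sub: "?V \<subseteq> ?f ` ?D"
  proof
    fix v assume "v \<in> ?V"
    then obtain j c where "j < n" "c \<in> ?U" "v = vec_rsmult R 3 (z j) c" using cover by blast
    then show "v \<in> ?f ` ?D" by (intro image_eqI[of _ _ "(c, j)"]) auto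
  qed
  have finD: "finite ?D" using fin by simp
  have "card (?f ` ?D) \<le> card ?V" using card_image_le[OF finD, of ?f] cD cV by simp
  then have image: "?f ` ?D = ?V" using card_seteq[OF _ sub] finD by auto
  have inj: "inj_on ?f ?D" using image cD cV finD by (intro eq_card_imp_inj_on) auto
  {
    assume "j < n"
    then have "?f (\<one>, j) \<in> ?V" unfolding image[symmetric] by (intro imageI) auto
    then show "z j \<noteq> vec_zero R 3" using z[OF \<open>j < n\<close>] by (auto simp: vec_rsmult_one)
  }
  {
    assume b: "b \<in> vecs R 3" "b \<noteq> vec_zero R 3"
    let ?Z = "{j. j < n \<and> dot R 3 b (z j) = \<zero>}"
    obtain i where i: "i < 3" "b i \<noteq> \<zero>" using b vec_nonzero_iff by blast
    then have bi: "b i \<in> carrier R" "inv b i \<in> carrier R" "inv b i \<otimes> b i = \<one>"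
      using b field_Units Units_l_inv Units_inv_closed by auto
    then have "dot R 3 (coord_vec 3 i (inv b i)) b = \<one>"
      using b i by (simp add: dot_coord_left)
    then have "card {v \<in> vecs R 3. dot R 3 v b = \<zero>} * q = q ^ 3"
      unfolding q using card_annihilator[OF fin _ b(1)] bi by blast
    moreover have "{v \<in> vecs R 3. dot R 3 v b = \<zero>} = insert (vec_zero R 3) (?f ` (?U \<times> ?Z))"
    proof -
      have "?f (c, j) \<in> {v. dot R 3 v b = \<zero>} \<longleftrightarrow> j \<in> ?Z" if "c \<in> ?U" "j < n" for c j
        using that b z[of j] dot_commute[of "vec_rsmult R 3 (z j) c" 3 b] integral_iff[of "dot R 3 b (z j)" c]
        by (simp add: dot_rsmult)
      then have "?f ` (?U \<times> ?Z) = {v \<in> ?f ` ?D. dot R 3 v b = \<zero>}" by auto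
      then show ?thesis unfolding image using b dot_zero_left by auto
    qed
    moreover have "vec_zero R 3 \<notin> ?f ` (?U \<times> ?Z)" using image by blast
    moreover have "card (?f ` (?U \<times> ?Z)) = (q - 1) * card ?Z"
      using inj_on_subset[OF inj, of "?U \<times> ?Z"] cU
      by (subst card_image) (auto simp: card_cartesian_product)
    ultimately have "((q - 1) * card ?Z + 1) * q = q ^ 3"
      using fin by (simp add: card_insert_if)
    then have eq: "((q - 1) * card ?Z + 1) * q = (q * q) * q" unfolding power3_eq_cube .
    have "q \<noteq> 0" using q2 by simp
    then have "(q - 1) * card ?Z + 1 = q * q" using eq by (rule mult_right_cancel[THEN iffD1])
    moreover have "q * q = (q - 1) * (q + 1) + 1"
      using q2 by (cases q) simp_all
    ultimately have eq': "(q - 1) * card ?Z = (q - 1) * (q + 1)" by linarith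
    have "q - 1 \<noteq> 0" using q2 by simp
    then show "card ?Z = q + 1" using eq' by (rule mult_left_cancel[THEN iffD1])
  }
qed

section \<open>Units and the homogeneous weight\<close>

context chain_ring_of_length_two
begin

lemma residue_closed [simp, intro]: "r \<in> carrier R \<Longrightarrow> \<pi> r \<in> carrier F"
  using ring_hom_closed[OF residue_hom] .

lemmas residue_simps [simp] =
  ring_hom_add[OF residue_hom] ring_hom_mult[OF residue_hom] ring_hom_one[OF residue_hom]

lemma residue_zero [simp]: "\<pi> \<zero> = \<zero>\<^bsub>F\<^esub>"
  using ring_hom_zero[OF residue_hom R.ring_axioms F.ring_axioms] .

lemma residue_minus [simp]: "r \<in> carrier R \<Longrightarrow> \<pi> (\<ominus> r) = \<ominus>\<^bsub>F\<^esub> \<pi> r"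
  using residue_simps(1)[of "\<ominus> r" r] by (intro F.minus_equality[symmetric]) (auto simp: R.l_neg simp del: residue_simps(1))

lemma sigma_hom: "\<sigma> \<in> ring_hom F F" and sigma_bij: "bij_betw \<sigma> (carrier F) (carrier F)"
  using sigma_iso by (auto simp: ring_iso_def)

lemma sigma_closed [simp, intro]: "a \<in> carrier F \<Longrightarrow> \<sigma> a \<in> carrier F"
  using ring_hom_closed[OF sigma_hom] .

lemma sigma_zero [simp]: "\<sigma> \<zero>\<^bsub>F\<^esub> = \<zero>\<^bsub>F\<^esub>"
  using ring_hom_zero[OF sigma_hom F.ring_axioms F.ring_axioms] .

lemma sigma_eq_zero_iff [simp]: "a \<in> carrier F \<Longrightarrow> \<sigma> a = \<zero>\<^bsub>F\<^esub> \<longleftrightarrow> a = \<zero>\<^bsub>F\<^esub>"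
  using bij_betw_imp_inj_on[OF sigma_bij] sigma_zero by (metis F.zero_closed inj_onD)

lemma rad_zero [simp]: "\<tau> \<zero>\<^bsub>F\<^esub> = \<zero>"
  using rad_add[of "\<zero>\<^bsub>F\<^esub>" "\<zero>\<^bsub>F\<^esub>"] R.add.l_cancel_one[of "\<tau> \<zero>\<^bsub>F\<^esub>" "\<tau> \<zero>\<^bsub>F\<^esub>"] by simp

lemma rad_eq_zero_iff [simp]: "a \<in> carrier F \<Longrightarrow> \<tau> a = \<zero> \<longleftrightarrow> a = \<zero>\<^bsub>F\<^esub>"
  using rad_inj rad_zero by (metis F.zero_closed inj_onD)

lemma residue_rad [simp]: "a \<in> carrier F \<Longrightarrow> \<pi> (\<tau> a) = \<zero>\<^bsub>F\<^esub>"
  using rad_eq by blast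

lemma residue_zeroE:
  assumes "r \<in> carrier R" "\<pi> r = \<zero>\<^bsub>F\<^esub>"
  obtains a where "a \<in> carrier F" "r = \<tau> a"
  using assms rad_eq by blast

text \<open>  Multiplying \<open>r\<close> by a representative of the inverse of its residue gives an element \<open>\<tau> b + 1\<close>, and
  \<open>1 - \<tau> b\<close> is its inverse because \<open>\<tau> b\<close> has square \<open>0\<close>.\<close>

lemma left_inverse_exists:
  assumes r: "r \<in> carrier R" "\<pi> r \<noteq> \<zero>\<^bsub>F\<^esub>"
  obtains s where "s \<in> carrier R" "s \<otimes> r = \<one>" "\<pi> s \<noteq> \<zero>\<^bsub>F\<^esub>"
proof -
  let ?a = "inv\<^bsub>F\<^esub> (\<pi> r)"
  have a: "?a \<in> carrier F" "?a \<otimes>\<^bsub>F\<^esub> \<pi> r = \<one>\<^bsub>F\<^esub>"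
    using r F.field_Units F.Units_l_inv F.Units_inv_closed by auto
  let ?t = "\<iota> ?a \<otimes> r"
  have t: "?t \<in> carrier R" using a r by simp
  have "\<pi> (?t \<oplus> \<ominus> \<one>) = \<zero>\<^bsub>F\<^esub>" using a r by (simp add: F.r_neg)
  then obtain b where b: "b \<in> carrier F" "?t \<oplus> \<ominus> \<one> = \<tau> b"
    using t by (metis R.a_inv_closed R.add.m_closed R.one_closed residue_zeroE)
  have t_eq: "?t = \<tau> b \<oplus> \<one>"
    using t b(2)[symmetric] by (simp add: R.a_assoc R.l_neg)
  let ?s = "(\<one> \<oplus> \<ominus> \<tau> b) \<otimes> \<iota> ?a"
  have nilpotent: "\<tau> b \<otimes> \<tau> b = \<zero>" using b mult_rad[of "\<tau> b" b] by simp
  have "?s \<otimes> r = (\<one> \<oplus> \<ominus> \<tau> b) \<otimes> ?t"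
    using a b r by (simp add: R.m_assoc)
  also have "\<dots> = \<one>" unfolding t_eq using b nilpotent
    by (simp add: R.l_distr R.r_distr R.l_minus R.a_assoc R.a_lcomm R.r_neg R.l_neg)
  finally have "?s \<otimes> r = \<one>" .
  moreover have s: "?s \<in> carrier R" using a b by simp
  moreover have "\<pi> ?s \<noteq> \<zero>\<^bsub>F\<^esub>"
    using residue_simps(2)[OF s r(1)] r calculation(1) by auto
  ultimately show ?thesis using that by blast
qed

lemma inverse_exists:
  assumes r: "r \<in> carrier R" "\<pi> r \<noteq> \<zero>\<^bsub>F\<^esub>"
  obtains s where "s \<in> carrier R" "s \<otimes> r = \<one>" "r \<otimes> s = \<one>"
proof -
  obtain s where s: "s \<in> carrier R" "s \<otimes> r = \<one>" "\<pi> s \<noteq> \<zero>\<^bsub>F\<^esub>"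
    using left_inverse_exists[OF r] .
  obtain t where t: "t \<in> carrier R" "t \<otimes> s = \<one>" using left_inverse_exists[OF s(1,3)] by blast
  have "t = t \<otimes> (s \<otimes> r)" using s t by simp
  also have "\<dots> = r" using s(1) t r(1) by (simp add: R.m_assoc[symmetric])
  finally show ?thesis using s t that by blast
qed

abbreviation q where "q \<equiv> card (carrier F)"

lemma q_ge_2: "2 \<le> q" using F.card_carrier_ge_2[OF finite_F] .

lemma card_kernel: "card {r \<in> carrier R. \<pi> r = \<zero>\<^bsub>F\<^esub>} = q"
  unfolding rad_eq[symmetric] using rad_inj by (rule card_image)

lemma carrier_bij: "bij_betw (\<lambda>(a, b). \<iota> a \<oplus> \<tau> b) (carrier F \<times> carrier F) (carrier R)"
proof (rule bij_betw_imageI)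
  let ?f = "\<lambda>(a, b). \<iota> a \<oplus> \<tau> b"
  show "inj_on ?f (carrier F \<times> carrier F)"
  proof (rule inj_onI, clarify)
    fix a b a' b' assume A: "a \<in> carrier F" "b \<in> carrier F" "a' \<in> carrier F" "b' \<in> carrier F"
      and eq: "\<iota> a \<oplus> \<tau> b = \<iota> a' \<oplus> \<tau> b'"
    have "\<pi> (\<iota> a \<oplus> \<tau> b) = \<pi> (\<iota> a' \<oplus> \<tau> b')" using eq by simp
    then have a: "a = a'" using A by simp
    then have "\<tau> b = \<tau> b'" using eq A by simp
    then show "a = a' \<and> b = b'" using a A rad_inj by (simp add: inj_on_eq_iff)
  qed
  show "?f ` (carrier F \<times> carrier F) = carrier R"
  proof (intro equalityI subsetI)
    fix r assume r: "r \<in> carrier R"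
    have "\<pi> (\<ominus> \<iota> (\<pi> r) \<oplus> r) = \<zero>\<^bsub>F\<^esub>" using r by (simp add: F.l_neg)
    then obtain b where b: "b \<in> carrier F" "\<ominus> \<iota> (\<pi> r) \<oplus> r = \<tau> b"
      using r by (metis R.a_inv_closed R.add.m_closed lift_closed residue_closed residue_zeroE)
    then have "r = \<iota> (\<pi> r) \<oplus> \<tau> b"
      using r b(2)[symmetric] by (simp add: R.r_neg2)
    then show "r \<in> ?f ` (carrier F \<times> carrier F)"
      using r b by (intro image_eqI[of _ _ "(\<pi> r, b)"]) auto
  qed auto
qed

lemma finite_R: "finite (carrier R)" and card_R: "card (carrier R) = q ^ 2"
  using carrier_bij finite_F bij_betw_finite bij_betw_same_card[OF carrier_bij]
  by (auto simp: card_cartesian_product power2_eq_square)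

lemma left_ideal_unit:
  assumes "r \<in> carrier R" "\<pi> r \<noteq> \<zero>\<^bsub>F\<^esub>"
  shows "left_ideal_gen R r = carrier R"
proof -
  obtain s where s: "s \<in> carrier R" "s \<otimes> r = \<one>" using inverse_exists[OF assms] by blast
  have "t = (t \<otimes> s) \<otimes> r" if "t \<in> carrier R" for t using s assms that by (simp add: R.m_assoc)
  then have "carrier R \<subseteq> left_ideal_gen R r"
    unfolding left_ideal_gen_def using s(1) by blast
  moreover have "left_ideal_gen R r \<subseteq> carrier R"
    unfolding left_ideal_gen_def using assms(1) by auto
  ultimately show ?thesis by blast
qed

lemma left_ideal_rad:
  assumes "r \<in> carrier R" "\<pi> r = \<zero>\<^bsub>F\<^esub>" "r \<noteq> \<zero>"
  shows "left_ideal_gen R r = {r \<in> carrier R. \<pi> r = \<zero>\<^bsub>F\<^esub>}"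
proof -
  obtain a where a: "a \<in> carrier F" "r = \<tau> a" using residue_zeroE assms by blast
  then have a0: "a \<noteq> \<zero>\<^bsub>F\<^esub>" using assms by auto
  have "\<tau> b \<in> left_ideal_gen R r" if b: "b \<in> carrier F" for b
  proof -
    have i: "inv\<^bsub>F\<^esub> a \<in> carrier F" "inv\<^bsub>F\<^esub> a \<otimes>\<^bsub>F\<^esub> a = \<one>\<^bsub>F\<^esub>"
      using a a0 F.field_Units F.Units_l_inv F.Units_inv_closed by auto
    then have "\<tau> b = \<iota> (b \<otimes>\<^bsub>F\<^esub> inv\<^bsub>F\<^esub> a) \<otimes> r"
      using a b by (simp add: mult_rad F.m_assoc)
    moreover have "\<iota> (b \<otimes>\<^bsub>F\<^esub> inv\<^bsub>F\<^esub> a) \<in> carrier R" using b i by blast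
    ultimately show ?thesis unfolding left_ideal_gen_def by blast
  qed
  then have "{r \<in> carrier R. \<pi> r = \<zero>\<^bsub>F\<^esub>} \<subseteq> left_ideal_gen R r"
    unfolding rad_eq[symmetric] by blast
  moreover have "left_ideal_gen R r \<subseteq> {r \<in> carrier R. \<pi> r = \<zero>\<^bsub>F\<^esub>}"
    unfolding left_ideal_gen_def using assms by auto
  ultimately show ?thesis by blast
qed

lemma left_ideal_zero: "left_ideal_gen R \<zero> = {\<zero>}"
proof -
  have "\<zero> = \<zero> \<otimes> \<zero>" by simp
  then have "\<zero> \<in> left_ideal_gen R \<zero>" unfolding left_ideal_gen_def using R.zero_closed by blast
  then show ?thesis unfolding left_ideal_gen_def by auto
qed

definition weight :: "'b \<Rightarrow> real" where
  "weight = (\<lambda>r\<in>carrier R. if r = \<zero> then 0 else if \<pi> r = \<zero>\<^bsub>F\<^esub> then q / (real q - 1) else 1)"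

lemma sum_split_kernel:
  fixes w :: "'b \<Rightarrow> real"
  shows "(\<Sum>r | r \<in> carrier R \<and> \<pi> r = \<zero>\<^bsub>F\<^esub>. w r)
      = w \<zero> + (\<Sum>r | r \<in> carrier R \<and> \<pi> r = \<zero>\<^bsub>F\<^esub> \<and> r \<noteq> \<zero>. w r)"
    and "(\<Sum>r\<in>carrier R. w r) = (\<Sum>r | r \<in> carrier R \<and> \<pi> r = \<zero>\<^bsub>F\<^esub>. w r)
      + (\<Sum>r | r \<in> carrier R \<and> \<pi> r \<noteq> \<zero>\<^bsub>F\<^esub>. w r)"
    and "card {r \<in> carrier R. \<pi> r = \<zero>\<^bsub>F\<^esub> \<and> r \<noteq> \<zero>} = q - 1"
    and "card {r \<in> carrier R. \<pi> r \<noteq> \<zero>\<^bsub>F\<^esub>} = q ^ 2 - q"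
proof -
  have K: "{r \<in> carrier R. \<pi> r = \<zero>\<^bsub>F\<^esub>} = insert \<zero> {r \<in> carrier R. \<pi> r = \<zero>\<^bsub>F\<^esub> \<and> r \<noteq> \<zero>}" by auto
  have C: "carrier R = {r \<in> carrier R. \<pi> r = \<zero>\<^bsub>F\<^esub>} \<union> {r \<in> carrier R. \<pi> r \<noteq> \<zero>\<^bsub>F\<^esub>}" by auto
  show "(\<Sum>r | r \<in> carrier R \<and> \<pi> r = \<zero>\<^bsub>F\<^esub>. w r)
      = w \<zero> + (\<Sum>r | r \<in> carrier R \<and> \<pi> r = \<zero>\<^bsub>F\<^esub> \<and> r \<noteq> \<zero>. w r)"
    using finite_R by (subst K) simp
  show "(\<Sum>r\<in>carrier R. w r) = (\<Sum>r | r \<in> carrier R \<and> \<pi> r = \<zero>\<^bsub>F\<^esub>. w r)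
      + (\<Sum>r | r \<in> carrier R \<and> \<pi> r \<noteq> \<zero>\<^bsub>F\<^esub>. w r)"
    using finite_R by (subst C, subst sum.union_disjoint) auto
  show "card {r \<in> carrier R. \<pi> r = \<zero>\<^bsub>F\<^esub> \<and> r \<noteq> \<zero>} = q - 1"
    using card_kernel finite_R unfolding K by simp
  have "{r \<in> carrier R. \<pi> r \<noteq> \<zero>\<^bsub>F\<^esub>} = carrier R - {r \<in> carrier R. \<pi> r = \<zero>\<^bsub>F\<^esub>}" by auto
  then show "card {r \<in> carrier R. \<pi> r \<noteq> \<zero>\<^bsub>F\<^esub>} = q ^ 2 - q"
    using card_kernel card_R finite_R by (simp add: card_Diff_subset)
qed

lemma card_left_ideal:
  "r \<in> carrier R \<Longrightarrow> card (left_ideal_gen R r)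
    = (if r = \<zero> then 1 else if \<pi> r = \<zero>\<^bsub>F\<^esub> then q else q ^ 2)"
  by (simp add: left_ideal_zero left_ideal_rad left_ideal_unit card_kernel card_R)

lemma q_less: "1 < real q" "q < q ^ 2"
  using q_ge_2 by (auto simp: power2_eq_square)

text \<open>  The three orbits \<open>{0}\<close>, radical without \<open>0\<close>, and units have left ideals of the distinct sizes \<open>1\<close>,
  \<open>q\<close> and \<open>q\<^sup>2\<close>, so \<open>weight\<close> is a function of the left ideal.\<close>

lemma homogeneous_weight_weight: "is_homogeneous_weight R weight"
  unfolding is_homogeneous_weight_def
proof (intro conjI ballI impI)
  show "weight \<in> carrier R \<rightarrow>\<^sub>E {0..}" using q_less by (auto simp: weight_def)
  show "weight \<zero> = 0" by (simp add: weight_def)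
  fix r s assume r: "r \<in> carrier R" and s: "s \<in> carrier R"
    and eq: "left_ideal_gen R r = left_ideal_gen R s"
  have "weight t = (if card (left_ideal_gen R t) = 1 then 0
      else if card (left_ideal_gen R t) = q then q / (real q - 1) else 1)" if "t \<in> carrier R" for t
    using that q_less q_ge_2 by (simp add: weight_def card_left_ideal)
  then show "weight r = weight s" using r s eq by simp
next
  have k: "(\<Sum>r | r \<in> carrier R \<and> \<pi> r = \<zero>\<^bsub>F\<^esub>. weight r) = real q"
  proof -
    have "(\<Sum>r | r \<in> carrier R \<and> \<pi> r = \<zero>\<^bsub>F\<^esub> \<and> r \<noteq> \<zero>. weight r) = real (q - 1) * (q / (real q - 1))"
      by (subst sum_split_kernel(3)[symmetric]) (simp add: weight_def)
    then show ?thesis using q_less by (simp add: sum_split_kernel(1) weight_def of_nat_diff)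
  qed
  have u: "(\<Sum>r\<in>carrier R. weight r) = real q ^ 2"
  proof -
    have "(\<Sum>r | r \<in> carrier R \<and> \<pi> r \<noteq> \<zero>\<^bsub>F\<^esub>. weight r) = (\<Sum>r | r \<in> carrier R \<and> \<pi> r \<noteq> \<zero>\<^bsub>F\<^esub>. 1)"
      by (rule sum.cong) (auto simp: weight_def)
    then have "(\<Sum>r | r \<in> carrier R \<and> \<pi> r \<noteq> \<zero>\<^bsub>F\<^esub>. weight r) = real (q ^ 2 - q)"
      by (simp add: sum_split_kernel(4))
    then show ?thesis using k q_less by (simp add: sum_split_kernel(2) of_nat_diff)
  qed
  fix r assume "r \<in> carrier R - {\<zero>}"
  then have r: "r \<in> carrier R" "r \<noteq> \<zero>" by auto
  show "(\<Sum>y\<in>left_ideal_gen R r. weight y) = real (card (left_ideal_gen R r))"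
  proof (cases "\<pi> r = \<zero>\<^bsub>F\<^esub>")
    case True
    show ?thesis unfolding left_ideal_rad[OF r(1) True r(2)] card_kernel by (rule k)
  next
    case False
    show ?thesis unfolding left_ideal_unit[OF r(1) False] card_R using u by simp
  qed
qed

text \<open>  The averaging condition for the radical determines the value on its \<open>q - 1\<close> nonzero elements, and
  the condition for the whole ring then determines the value on the units.\<close>

lemma homogeneous_weight_unique:
  assumes w: "is_homogeneous_weight R w"
  shows "w = weight"
proof
  have q: "1 < real q" "q \<le> q ^ 2" using q_less by auto
  have w0: "w \<zero> = 0" and wE: "w \<in> carrier R \<rightarrow>\<^sub>E {0..}"
    and wc: "\<And>x y. x \<in> carrier R \<Longrightarrow> y \<in> carrier R \<Longrightarrow> left_ideal_gen R x = left_ideal_gen R y \<Longrightarrow> w x = w y"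
    and ws: "\<And>x. x \<in> carrier R \<Longrightarrow> x \<noteq> \<zero> \<Longrightarrow> (\<Sum>y\<in>left_ideal_gen R x. w y) = real (card (left_ideal_gen R x))"
    using w unfolding is_homogeneous_weight_def by blast+
  have k: "(real q - 1) * w r = real q" if r: "r \<in> carrier R" "\<pi> r = \<zero>\<^bsub>F\<^esub>" "r \<noteq> \<zero>" for r
  proof -
    have "(\<Sum>s | s \<in> carrier R \<and> \<pi> s = \<zero>\<^bsub>F\<^esub> \<and> s \<noteq> \<zero>. w s) = (\<Sum>s | s \<in> carrier R \<and> \<pi> s = \<zero>\<^bsub>F\<^esub> \<and> s \<noteq> \<zero>. w r)"
      using r by (intro sum.cong wc) (auto simp: left_ideal_rad)
    then show ?thesis
      using ws[OF r(1,3)] q w0 card_kernel unfolding left_ideal_rad[OF r]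
      by (simp add: sum_split_kernel(1,3) of_nat_diff)
  qed
  have "\<tau> \<one>\<^bsub>F\<^esub> \<in> carrier R" "\<pi> (\<tau> \<one>\<^bsub>F\<^esub>) = \<zero>\<^bsub>F\<^esub>" "\<tau> \<one>\<^bsub>F\<^esub> \<noteq> \<zero>" by auto
  then have kernel_sum: "(\<Sum>s | s \<in> carrier R \<and> \<pi> s = \<zero>\<^bsub>F\<^esub>. w s) = real q"
    using ws[of "\<tau> \<one>\<^bsub>F\<^esub>"] left_ideal_rad[of "\<tau> \<one>\<^bsub>F\<^esub>"] card_kernel by simp
  have u: "w r = 1" if r: "r \<in> carrier R" "\<pi> r \<noteq> \<zero>\<^bsub>F\<^esub>" for r
  proof -
    have "(\<Sum>s | s \<in> carrier R \<and> \<pi> s \<noteq> \<zero>\<^bsub>F\<^esub>. w s) = (\<Sum>s | s \<in> carrier R \<and> \<pi> s \<noteq> \<zero>\<^bsub>F\<^esub>. w r)"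
      using r by (intro sum.cong wc) (auto simp: left_ideal_unit)
    moreover have "r \<noteq> \<zero>" using r by auto
    then have "(\<Sum>s\<in>carrier R. w s) = real (q ^ 2)"
      using ws[OF r(1)] unfolding left_ideal_unit[OF r] card_R by simp
    ultimately have "real q + (real q ^ 2 - real q) * w r = real q ^ 2"
      using kernel_sum q by (simp add: sum_split_kernel(2,4) of_nat_diff)
    then have "(real q ^ 2 - real q) * w r = real q ^ 2 - real q"
      by (simp only: eq_diff_eq add.commute)
    then have "real q ^ 2 - real q = 0 \<or> w r = 1" by (simp only: mult_cancel_left2)
    then show ?thesis using q(1) by (simp add: power2_eq_square)
  qed
  fix r show "w r = weight r"
  proof (cases "r \<in> carrier R")
    case True
    then show ?thesis using k[of r] u[of r] w0 q by (auto simp: weight_def field_simps)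
  next
    case False
    then show ?thesis using wE by (auto simp: weight_def)
  qed
qed

lemma whom_eq: "whom R = weight"
  unfolding whom_def using homogeneous_weight_weight homogeneous_weight_unique by (rule the_equality)

end

section \<open>Weights of a set of points that covers the residue plane\<close>

text \<open>  The numerical contradiction that rules out that all hyperplanes are tangent; see
  \<open>exists_secant_hyperplane\<close>. Equality would reduce to \<open>q\<^sup>5 = q\<^sup>2\<close>.\<close>

lemma incidence_count_absurd:
  fixes q :: nat
  assumes q: "2 \<le> q"
  shows "(q ^ 2 + q + 1) * q ^ 4 \<noteq> (q ^ 2 + q + 1) + ((q ^ 3 - 1) * (q + 1) + (q ^ 6 - q ^ 3))"
proof
  assume eq: "(q ^ 2 + q + 1) * q ^ 4 = (q ^ 2 + q + 1) + ((q ^ 3 - 1) * (q + 1) + (q ^ 6 - q ^ 3))"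
  have "1 \<le> q ^ 3" "q ^ 3 \<le> q ^ 6" using q by (auto intro: power_increasing)
  then obtain a b where a: "q ^ 3 = a + 1" and b: "q ^ 6 = q ^ 3 + b"
    by (metis add.commute le_Suc_ex)
  have "(q ^ 2 + q + 1) * q ^ 4 + (q + 1) + q ^ 3 = (q ^ 2 + q + 1) + (a + 1) * (q + 1) + (q ^ 3 + b)"
    using eq unfolding b unfolding a by (simp add: algebra_simps)
  also have "\<dots> = (q ^ 2 + q + 1) + q ^ 3 * (q + 1) + q ^ 6" unfolding a[symmetric] b[symmetric] ..
  finally have "q ^ 5 = q ^ 2" by (simp add: algebra_simps eval_nat_numeral)
  then show False using power_strict_increasing[of 2 5 q] q by simp
qed

context chain_ring_of_length_two
begin

abbreviation residue_vec :: "nat \<Rightarrow> (nat \<Rightarrow> 'b) \<Rightarrow> nat \<Rightarrow> 'a" where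
  "residue_vec m x \<equiv> \<lambda>i\<in>{..<m}. \<pi> (x i)"

abbreviation rad_vec :: "nat \<Rightarrow> (nat \<Rightarrow> 'a) \<Rightarrow> nat \<Rightarrow> 'b" where
  "rad_vec m b \<equiv> \<lambda>i\<in>{..<m}. \<tau> (b i)"

lemma residue_vec_closed [simp, intro]: "x \<in> vecs R m \<Longrightarrow> residue_vec m x \<in> vecs F m"
  by auto

lemma rad_vec_closed [simp, intro]: "b \<in> vecs F m \<Longrightarrow> rad_vec m b \<in> vecs R m"
  by auto

lemma residue_finsum:
  "(\<And>i. i < m \<Longrightarrow> f i \<in> carrier R)
    \<Longrightarrow> \<pi> (\<Oplus>i\<in>{..<m::nat}. f i) = (\<Oplus>\<^bsub>F\<^esub>i\<in>{..<m}. \<pi> (f i))"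
proof (induction m)
  case (Suc m)
  then show ?case
    by (simp add: lessThan_Suc R.finsum_insert F.finsum_insert Pi_def)
qed simp

lemma rad_finsum:
  "(\<And>i. i < m \<Longrightarrow> f i \<in> carrier F)
    \<Longrightarrow> \<tau> (\<Oplus>\<^bsub>F\<^esub>i\<in>{..<m::nat}. f i) = (\<Oplus>i\<in>{..<m}. \<tau> (f i))"
proof (induction m)
  case (Suc m)
  then show ?case
    by (simp add: lessThan_Suc R.finsum_insert F.finsum_insert Pi_def rad_add)
qed simp

lemma residue_dot:
  assumes "x \<in> vecs R m" "y \<in> vecs R m"
  shows "\<pi> (dot R m x y) = dot F m (residue_vec m x) (residue_vec m y)"
proof -
  have "\<pi> (dot R m x y) = (\<Oplus>\<^bsub>F\<^esub>i\<in>{..<m}. \<pi> (x i \<otimes> y i))"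
    unfolding dot_def using assms by (intro residue_finsum) auto
  also have "\<dots> = dot F m (residue_vec m x) (residue_vec m y)"
    unfolding dot_def using assms by (intro F.finsum_cong') (auto simp: vecs_apply[of x R m] vecs_apply[of y R m])
  finally show ?thesis .
qed

lemma rad_vec_dot:
  assumes "b \<in> vecs F m" "y \<in> vecs R m"
  shows "dot R m (rad_vec m b) y = \<tau> (dot F m b (\<lambda>i\<in>{..<m}. \<sigma> (\<pi> (y i))))"
proof -
  have "dot R m (rad_vec m b) y = (\<Oplus>i\<in>{..<m}. \<tau> (b i \<otimes>\<^bsub>F\<^esub> \<sigma> (\<pi> (y i))))"
    unfolding dot_def using assms
    by (intro R.finsum_cong') (auto simp: rad_mult vecs_apply[of b F m] vecs_apply[of y R m])
  also have "\<dots> = \<tau> (\<Oplus>\<^bsub>F\<^esub>i\<in>{..<m}. b i \<otimes>\<^bsub>F\<^esub> \<sigma> (\<pi> (y i)))"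
    using assms by (intro rad_finsum[symmetric]) auto
  also have "(\<Oplus>\<^bsub>F\<^esub>i\<in>{..<m}. b i \<otimes>\<^bsub>F\<^esub> \<sigma> (\<pi> (y i))) = dot F m b (\<lambda>i\<in>{..<m}. \<sigma> (\<pi> (y i)))"
    unfolding dot_def using assms by (intro F.finsum_cong') auto
  finally show ?thesis .
qed

lemma residue_vec_zeroE:
  assumes x: "x \<in> vecs R m" and "residue_vec m x = vec_zero F m"
  obtains b where "b \<in> vecs F m" "x = rad_vec m b"
proof -
  have "\<exists>a\<in>carrier F. x i = \<tau> a" if "i < m" for i
    using that fun_cong[OF assms(2), of i] residue_zeroE[of "x i"] x by (auto simp: vec_zero_def)
  then obtain b where b: "\<And>i. i < m \<Longrightarrow> b i \<in> carrier F \<and> x i = \<tau> (b i)" by metis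
  let ?b = "\<lambda>i\<in>{..<m}. b i"
  have "?b \<in> vecs F m" using b by auto
  moreover have "x = rad_vec m ?b" by (rule vecs_eqI[OF x]) (use b in auto)
  ultimately show ?thesis by (rule that)
qed

text \<open>  A vector with nonzero residue has a unit coordinate; its inverse, placed at that coordinate, is
  the required \<open>u\<close>.\<close>

lemma unimodular_vec:
  assumes x: "x \<in> vecs R m" and nz: "residue_vec m x \<noteq> vec_zero F m"
  obtains u where "u \<in> vecs R m" "dot R m u x = \<one>" "dot R m x u = \<one>"
proof -
  obtain i where i: "i < m" "\<pi> (x i) \<noteq> \<zero>\<^bsub>F\<^esub>"
    using nz F.vec_nonzero_iff[of "residue_vec m x" m] x by auto
  then obtain s where s: "s \<in> carrier R" "s \<otimes> x i = \<one>" "x i \<otimes> s = \<one>"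
    using inverse_exists[of "x i"] x by blast
  then show ?thesis
    using that[of "R.coord_vec m i s"] x i by (simp add: R.dot_coord_left R.dot_coord_right)
qed

lemma residue_vec_rsmult:
  "x \<in> vecs R m \<Longrightarrow> r \<in> carrier R
    \<Longrightarrow> residue_vec m (vec_rsmult R m x r) = vec_rsmult F m (residue_vec m x) (\<pi> r)"
  by (auto simp: vec_rsmult_def fun_eq_iff vecs_apply[of x R m])

text \<open>  For the matrix with columns \<open>y\<^sub>j\<close> this is the weight of the codeword of the row vector \<open>x\<close>, see
  \<open>two_weight_row_code\<close>.\<close>

definition sum_weight :: "nat \<Rightarrow> (nat \<Rightarrow> nat \<Rightarrow> 'b) \<Rightarrow> (nat \<Rightarrow> 'b) \<Rightarrow> real" where
  "sum_weight n y x = (\<Sum>j<n. weight (dot R 3 x (y j)))"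

definition zeros :: "nat \<Rightarrow> (nat \<Rightarrow> nat \<Rightarrow> 'b) \<Rightarrow> (nat \<Rightarrow> 'b) \<Rightarrow> nat set" where
  "zeros n y x = {j. j < n \<and> dot R 3 x (y j) = \<zero>}"

definition residue_zeros :: "nat \<Rightarrow> (nat \<Rightarrow> nat \<Rightarrow> 'b) \<Rightarrow> (nat \<Rightarrow> 'b) \<Rightarrow> nat set" where
  "residue_zeros n y x = {j. j < n \<and> \<pi> (dot R 3 x (y j)) = \<zero>\<^bsub>F\<^esub>}"

lemma sum_weight_eq:
  assumes x: "x \<in> vecs R 3" and y: "\<And>j. j < n \<Longrightarrow> y j \<in> vecs R 3"
  shows "sum_weight n y x = (real (card (residue_zeros n y x)) - real (card (zeros n y x))) * (q / (real q - 1))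
    + (real n - real (card (residue_zeros n y x)))"
proof -
  let ?Z = "zeros n y x" and ?T = "residue_zeros n y x"
  have sub: "?Z \<subseteq> ?T" "?T \<subseteq> {..<n}" by (auto simp: zeros_def residue_zeros_def)
  have fin: "finite ?T" by (rule finite_subset[OF sub(2)]) simp
  have fin': "finite ?Z" by (rule finite_subset[OF sub(1) fin])
  have "sum_weight n y x = (\<Sum>j\<in>{..<n} - ?T. weight (dot R 3 x (y j)))
      + ((\<Sum>j\<in>?T - ?Z. weight (dot R 3 x (y j))) + (\<Sum>j\<in>?Z. weight (dot R 3 x (y j))))"
    unfolding sum_weight_def sum.subset_diff[OF sub(2) finite_lessThan] sum.subset_diff[OF sub(1) fin] ..
  also have "(\<Sum>j\<in>?Z. weight (dot R 3 x (y j))) = 0"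
    by (rule sum.neutral) (auto simp: zeros_def weight_def)
  also have "(\<Sum>j\<in>?T - ?Z. weight (dot R 3 x (y j))) = (\<Sum>j\<in>?T - ?Z. q / (real q - 1))"
    using x y by (intro sum.cong) (auto simp: zeros_def residue_zeros_def weight_def)
  also have "(\<Sum>j\<in>{..<n} - ?T. weight (dot R 3 x (y j))) = (\<Sum>j\<in>{..<n} - ?T. 1)"
    using x y by (intro sum.cong) (auto simp: residue_zeros_def weight_def)
  also have "(\<Sum>j\<in>?T - ?Z. q / (real q - 1)) = (real (card ?T) - real (card ?Z)) * (q / (real q - 1))"
    using card_mono[OF fin sub(1)] card_Diff_subset[OF fin' sub(1)] by (simp add: of_nat_diff)
  also have "(\<Sum>j\<in>{..<n} - ?T. 1) = real n - real (card ?T)"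
    using card_mono[OF _ sub(2)] card_Diff_subset[OF fin sub(2)] by (simp add: of_nat_diff)
  finally show ?thesis by simp
qed

lemma vec_zero_in: "vec_zero R m \<in> vecs R m" "vec_zero F m \<in> vecs F m"
  by auto

end

text \<open>  The properties of the orbit that matter: the residues of its points cover the plane over the
  residue field, and each hyperplane contains one or \<open>q + 1\<close> of its points.\<close>

locale covering_arc = chain_ring_of_length_two R F \<sigma> \<pi> \<iota> \<tau>
  for R :: "('b, 'n) ring_scheme" (structure) and F :: "('a, 'm) ring_scheme" and \<sigma> \<pi> \<iota> \<tau> +
  fixes n :: nat and y :: "nat \<Rightarrow> nat \<Rightarrow> 'b"
  assumes n: "n = q ^ 2 + q + 1"
    and y: "\<And>j. j < n \<Longrightarrow> y j \<in> vecs R 3"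
    and cover: "\<And>v. v \<in> vecs F 3 \<Longrightarrow> v \<noteq> vec_zero F 3
      \<Longrightarrow> \<exists>j<n. \<exists>c\<in>carrier F - {\<zero>\<^bsub>F\<^esub>}. v = vec_rsmult F 3 (residue_vec 3 (y j)) c"
    and hyperplane: "\<And>x. x \<in> vecs R 3 \<Longrightarrow> residue_vec 3 x \<noteq> vec_zero F 3
      \<Longrightarrow> card (zeros n y x) \<in> {1, q + 1}"
begin

lemma residue_nonzero: "j < n \<Longrightarrow> residue_vec 3 (y j) \<noteq> vec_zero F 3"
  by (rule F.covering_points_incidence(1)[OF finite_F refl n _ cover]) (use y in auto)

lemma card_residue_zeros:
  assumes x: "x \<in> vecs R 3" and nz: "residue_vec 3 x \<noteq> vec_zero F 3"
  shows "card (residue_zeros n y x) = q + 1"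
proof -
  have "residue_zeros n y x = {j. j < n \<and> dot F 3 (residue_vec 3 x) (residue_vec 3 (y j)) = \<zero>\<^bsub>F\<^esub>}"
    unfolding residue_zeros_def using x y by (auto simp: residue_dot)
  moreover have "card {j. j < n \<and> dot F 3 (residue_vec 3 x) (residue_vec 3 (y j)) = \<zero>\<^bsub>F\<^esub>} = q + 1"
    by (rule F.covering_points_incidence(2)[OF finite_F refl n _ cover _ nz]) (use x y in auto)
  ultimately show ?thesis by simp
qed

text \<open>  Because \<open>\<sigma>\<close> is bijective, the conjugated residues cover the plane as well. They enter through the
  rule \<open>(bX) y = (b \<sigma>(\<pi>(y))) X\<close> for row vectors \<open>bX\<close> in the radical.\<close>

lemma cover_sigma:
  assumes v: "v \<in> vecs F 3" "v \<noteq> vec_zero F 3"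
  shows "\<exists>j<n. \<exists>c\<in>carrier F - {\<zero>\<^bsub>F\<^esub>}. v = vec_rsmult F 3 (\<lambda>i\<in>{..<3}. \<sigma> (\<pi> (y j i))) c"
proof -
  let ?s = "inv_into (carrier F) \<sigma>"
  have s: "?s a \<in> carrier F" "\<sigma> (?s a) = a" if "a \<in> carrier F" for a
    using that sigma_bij by (auto simp: bij_betw_def inv_into_into f_inv_into_f)
  let ?u = "\<lambda>i\<in>{..<3}. ?s (v i)"
  have u: "?u \<in> vecs F 3" using v s by auto
  have "?u \<noteq> vec_zero F 3"
  proof
    assume *: "?u = vec_zero F 3"
    have "v i = \<zero>\<^bsub>F\<^esub>" if "i < 3" for i
      using s(2)[of "v i"] fun_cong[OF *, of i] v(1) that by (simp add: vec_zero_def)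
    then show False using v F.vec_nonzero_iff by blast
  qed
  then obtain j c where jc: "j < n" "c \<in> carrier F - {\<zero>\<^bsub>F\<^esub>}" "?u = vec_rsmult F 3 (residue_vec 3 (y j)) c"
    using cover[OF u] by blast
  have "v = vec_rsmult F 3 (\<lambda>i\<in>{..<3}. \<sigma> (\<pi> (y j i))) (\<sigma> c)"
  proof (rule vecs_eqI[OF v(1)])
    show "vec_rsmult F 3 (\<lambda>i\<in>{..<3}. \<sigma> (\<pi> (y j i))) (\<sigma> c) \<in> vecs F 3"
      using jc y[of j] by (intro F.vec_rsmult_closed restrict_vecs) auto
    fix i :: nat assume i: "i < 3"
    have "v i = \<sigma> (?u i)" using s(2)[of "v i"] v i by simp
    also have "?u i = \<pi> (y j i) \<otimes>\<^bsub>F\<^esub> c" using fun_cong[OF jc(3), of i] i by (simp add: vec_rsmult_def)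
    also have "\<sigma> \<dots> = \<sigma> (\<pi> (y j i)) \<otimes>\<^bsub>F\<^esub> \<sigma> c"
      using i jc y[of j] by (intro ring_hom_mult[OF sigma_hom]) auto
    finally show "v i = vec_rsmult F 3 (\<lambda>i\<in>{..<3}. \<sigma> (\<pi> (y j i))) (\<sigma> c) i"
      using i by (simp add: vec_rsmult_def)
  qed
  moreover have "\<sigma> c \<in> carrier F - {\<zero>\<^bsub>F\<^esub>}" using jc by auto
  ultimately show ?thesis using jc(1) by blast
qed

lemma card_zeros_rad:
  assumes x: "x \<in> vecs R 3" and nz: "x \<noteq> vec_zero R 3" and res: "residue_vec 3 x = vec_zero F 3"
  shows "card (zeros n y x) = q + 1" and "residue_zeros n y x = {..<n}"
proof -
  obtain b where b: "b \<in> vecs F 3" "x = rad_vec 3 b" using residue_vec_zeroE[OF x res] .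
  have b0: "b \<noteq> vec_zero F 3"
  proof
    assume "b = vec_zero F 3"
    then have "x = vec_zero R 3"
      by (intro vecs_eqI[OF x vec_zero_in(1)]) (simp add: b(2) vec_zero_def)
    then show False using nz by simp
  qed
  have s: "(\<lambda>i\<in>{..<3}. \<sigma> (\<pi> (y j i))) \<in> vecs F 3" if "j < n" for j
    using y[OF that] by (intro restrict_vecs) auto
  have "zeros n y x = {j. j < n \<and> dot F 3 b (\<lambda>i\<in>{..<3}. \<sigma> (\<pi> (y j i))) = \<zero>\<^bsub>F\<^esub>}"
    unfolding zeros_def b(2) using b(1) y s F.dot_closed by (auto simp: rad_vec_dot)
  moreover have "card {j. j < n \<and> dot F 3 b (\<lambda>i\<in>{..<3}. \<sigma> (\<pi> (y j i))) = \<zero>\<^bsub>F\<^esub>} = q + 1"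
    using F.covering_points_incidence(2)[OF finite_F refl n s cover_sigma b(1) b0] by blast
  ultimately show "card (zeros n y x) = q + 1" by simp
  show "residue_zeros n y x = {..<n}"
    unfolding residue_zeros_def b(2) using b(1) y s F.dot_closed by (auto simp: rad_vec_dot)
qed

text \<open>  Count the pairs \<open>(x, j)\<close> with \<open>x y\<^sub>j = 0\<close>. For each of the \<open>n\<close> points there are \<open>q\<^sup>4\<close> vectors \<open>x\<close>. On the
  other hand \<open>x = 0\<close> accounts for \<open>n\<close> pairs, each of the \<open>q\<^sup>3 - 1\<close> other vectors in the radical for
  \<open>q + 1\<close>, and each of the \<open>q\<^sup>6 - q\<^sup>3\<close> remaining vectors would account for one if there were no
  hyperplane with \<open>q + 1\<close> points.\<close>

lemma exists_secant_hyperplane: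
  "\<exists>x\<in>vecs R 3. residue_vec 3 x \<noteq> vec_zero F 3 \<and> card (zeros n y x) = q + 1"
proof (rule ccontr)
  assume none: "\<not> ?thesis"
  have tangent: "card (zeros n y x) = 1" if "x \<in> vecs R 3" "residue_vec 3 x \<noteq> vec_zero F 3" for x
    using hyperplane[OF that] that none by blast
  let ?V = "vecs R 3"
  let ?rad = "{x \<in> ?V. residue_vec 3 x = vec_zero F 3}"
  have finV: "finite ?V" using finite_R by (rule finite_vecs)
  have rad_image: "?rad = (rad_vec 3) ` vecs F 3"
  proof (intro equalityI subsetI)
    fix x assume "x \<in> ?rad"
    then have x: "x \<in> ?V" "residue_vec 3 x = vec_zero F 3" by auto
    obtain b where b: "b \<in> vecs F 3" "x = rad_vec 3 b" using residue_vec_zeroE[OF x] .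
    show "x \<in> (rad_vec 3) ` vecs F 3" unfolding b(2) using b(1) by (rule imageI)
  next
    fix x assume "x \<in> (rad_vec 3) ` vecs F 3"
    then obtain b where b: "b \<in> vecs F 3" "x = rad_vec 3 b" by (rule imageE)
    have x: "x \<in> ?V" unfolding b(2) using b(1) by (rule rad_vec_closed)
    have "residue_vec 3 x = vec_zero F 3"
      using b(1) by (intro vecs_eqI[OF residue_vec_closed[OF x] vec_zero_in(2)]) (simp add: b(2) vec_zero_def vecs_apply)
    then show "x \<in> ?rad" using x by simp
  qed
  have "inj_on (rad_vec 3) (vecs F 3)"
  proof (rule inj_onI)
    fix b c assume bc: "b \<in> vecs F 3" "c \<in> vecs F 3" "rad_vec 3 b = rad_vec 3 c"
    have "b i = c i" if "i < 3" for i
      using fun_cong[OF bc(3), of i] that bc(1,2) inj_onD[OF rad_inj, of "b i" "c i"] by simp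
    then show "b = c" using vecs_eqI bc by blast
  qed
  then have card_rad: "card ?rad = q ^ 3" unfolding rad_image by (simp add: card_image card_vecs)
  have cardV: "card ?V = q ^ 6" by (simp add: card_vecs card_R flip: power_mult)
  have zero_in: "vec_zero R 3 \<in> ?rad" by (auto simp: vec_zero_def fun_eq_iff)
  have point: "card {x \<in> ?V. dot R 3 x (y j) = \<zero>} = q ^ 4" if j: "j < n" for j
  proof -
    obtain u where u: "u \<in> vecs R 3" "dot R 3 u (y j) = \<one>"
      using unimodular_vec[OF y[OF j] residue_nonzero[OF j]] by blast
    have eq: "card {x \<in> ?V. dot R 3 x (y j) = \<zero>} * q ^ 2 = q ^ 4 * q ^ 2"
      using R.card_annihilator[OF finite_R u(1) y[OF j] u(2)] unfolding card_R
      by (simp flip: power_mult power_add)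
    have "q ^ 2 \<noteq> 0" using q_ge_2 by simp
    then show ?thesis using eq by (rule mult_right_cancel[THEN iffD1])
  qed
  have "(\<Sum>x\<in>?V. card (zeros n y x)) = (\<Sum>x\<in>?V. \<Sum>j<n. if dot R 3 x (y j) = \<zero> then 1 else 0)"
    unfolding zeros_def by (simp add: sum.If_cases Int_def)
  also have "\<dots> = (\<Sum>j<n. \<Sum>x\<in>?V. if dot R 3 x (y j) = \<zero> then 1 else 0)"
    by (rule sum.swap)
  also have "\<dots> = (\<Sum>j<n. card {x \<in> ?V. dot R 3 x (y j) = \<zero>})"
    using finV by (simp add: sum.If_cases Int_def)
  also have "\<dots> = n * q ^ 4" by (simp add: point)
  finally have by_points: "(\<Sum>x\<in>?V. card (zeros n y x)) = n * q ^ 4" .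
  have V: "?V = insert (vec_zero R 3) ((?rad - {vec_zero R 3}) \<union> (?V - ?rad))"
    using zero_in by auto
  have zz: "card (zeros n y (vec_zero R 3)) = n"
    unfolding zeros_def using y by (simp add: R.dot_zero_left cong: conj_cong)
  have "(\<Sum>x\<in>?rad - {vec_zero R 3}. card (zeros n y x)) = (\<Sum>x\<in>?rad - {vec_zero R 3}. q + 1)"
    by (rule sum.cong) (auto simp: card_zeros_rad(1))
  moreover have "\<dots> = (q ^ 3 - 1) * (q + 1)"
    using zero_in finV card_rad by (simp add: card_Diff_singleton)
  moreover have "(\<Sum>x\<in>?V - ?rad. card (zeros n y x)) = (\<Sum>x\<in>?V - ?rad. 1)"
    by (rule sum.cong) (auto simp: tangent)
  moreover have "\<dots> = q ^ 6 - q ^ 3"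
    using finV card_rad cardV card_Diff_subset[of ?rad ?V] by (simp add: finite_subset[of ?rad ?V])
  moreover have "(\<Sum>x\<in>?V. card (zeros n y x)) = n + ((\<Sum>x\<in>?rad - {vec_zero R 3}. card (zeros n y x))
      + (\<Sum>x\<in>?V - ?rad. card (zeros n y x)))"
    using finV zero_in zz by (subst V) (subst sum.insert, auto intro!: sum.union_disjoint)
  ultimately have "n * q ^ 4 = n + ((q ^ 3 - 1) * (q + 1) + (q ^ 6 - q ^ 3))"
    using by_points by simp
  then show False using incidence_count_absurd[OF q_ge_2] unfolding n by blast
qed

lemma weight_values:
  "real q / (real q - 1) * real q + real q ^ 2 = real q ^ 3 / (real q - 1)"
  "real q ^ 2 * (real q / (real q - 1)) = real q ^ 3 / (real q - 1)"
  using q_less by (simp_all add: field_simps power2_eq_square power3_eq_cube)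

lemma sum_weight_cases:
  assumes x: "x \<in> vecs R 3"
  shows "x = vec_zero R 3 \<Longrightarrow> sum_weight n y x = 0"
    and "x \<noteq> vec_zero R 3 \<Longrightarrow> residue_vec 3 x = vec_zero F 3 \<Longrightarrow> sum_weight n y x = real q ^ 3 / (real q - 1)"
    and "residue_vec 3 x \<noteq> vec_zero F 3 \<Longrightarrow> card (zeros n y x) = 1 \<Longrightarrow> sum_weight n y x = real q ^ 3 / (real q - 1)"
    and "residue_vec 3 x \<noteq> vec_zero F 3 \<Longrightarrow> card (zeros n y x) = q + 1 \<Longrightarrow> sum_weight n y x = real q ^ 2"
proof -
  have eq: "sum_weight n y x = (real (card (residue_zeros n y x)) - real (card (zeros n y x))) * (q / (real q - 1))
      + (real n - real (card (residue_zeros n y x)))"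
    using x y by (rule sum_weight_eq)
  have rn: "real n = real q ^ 2 + real q + 1" unfolding n by simp
  show "sum_weight n y x = 0" if "x = vec_zero R 3"
    using y by (simp add: that sum_weight_def R.dot_zero_left weight_def)
  show "sum_weight n y x = real q ^ 3 / (real q - 1)" if "x \<noteq> vec_zero R 3" "residue_vec 3 x = vec_zero F 3"
  proof -
    have "sum_weight n y x = (real n - real (q + 1)) * (real q / (real q - 1))"
      unfolding eq card_zeros_rad(1)[OF x that] card_zeros_rad(2)[OF x that] card_lessThan
      by (simp only: diff_self add_0_right)
    also have "real n - real (q + 1) = real q ^ 2" by (simp add: rn)
    finally show ?thesis unfolding weight_values(2) .
  qed
  assume nz: "residue_vec 3 x \<noteq> vec_zero F 3"
  show "sum_weight n y x = real q ^ 3 / (real q - 1)" if "card (zeros n y x) = 1"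
  proof -
    have "sum_weight n y x = real q / (real q - 1) * real q + real q ^ 2"
      unfolding eq card_residue_zeros[OF x nz] that by (simp add: rn)
    then show ?thesis unfolding weight_values(1) .
  qed
  show "sum_weight n y x = real q ^ 2" if "card (zeros n y x) = q + 1"
    unfolding eq card_residue_zeros[OF x nz] that by (simp add: rn)
qed

lemma weights_distinct: "real q ^ 3 / (real q - 1) \<noteq> real q ^ 2" "0 < real q ^ 3 / (real q - 1)" "0 < real q ^ 2"
  using q_less by (auto simp: field_simps power2_eq_square power3_eq_cube)

lemma sum_weight_nonzero:
  assumes x: "x \<in> vecs R 3" "x \<noteq> vec_zero R 3"
  shows "sum_weight n y x \<in> {real q ^ 3 / (real q - 1), real q ^ 2}"
  using sum_weight_cases(2-4)[OF x(1)] hyperplane[OF x(1)] x(2)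
  by (cases "residue_vec 3 x = vec_zero F 3") auto

lemma sum_weight_image: "sum_weight n y ` vecs R 3 - {0} = {real q ^ 3 / (real q - 1), real q ^ 2}"
proof (intro equalityI subsetI)
  fix w assume "w \<in> sum_weight n y ` vecs R 3 - {0}"
  then show "w \<in> {real q ^ 3 / (real q - 1), real q ^ 2}"
    using sum_weight_cases(1) sum_weight_nonzero by blast
next
  fix w assume w: "w \<in> {real q ^ 3 / (real q - 1), real q ^ 2}"
  \<comment> \<open>Any nonzero vector in the radical attains the first weight.\<close>
  let ?x = "rad_vec 3 (\<lambda>i\<in>{..<3}. \<one>\<^bsub>F\<^esub>)"
  have x: "?x \<in> vecs R 3" by auto
  moreover have "?x \<noteq> vec_zero R 3"
  proof
    assume "?x = vec_zero R 3"
    then have "?x 0 = vec_zero R 3 0" by (rule fun_cong)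
    then show False by (simp add: vec_zero_def)
  qed
  moreover have "residue_vec 3 ?x = vec_zero F 3"
    by (rule vecs_eqI[OF residue_vec_closed[OF x] vec_zero_in(2)]) (simp add: vec_zero_def)
  ultimately have 1: "sum_weight n y ?x = real q ^ 3 / (real q - 1)" by (rule sum_weight_cases(2))
  obtain x' where x': "x' \<in> vecs R 3" "residue_vec 3 x' \<noteq> vec_zero F 3" "card (zeros n y x') = q + 1"
    using exists_secant_hyperplane by blast
  then have 2: "sum_weight n y x' = real q ^ 2" by (rule sum_weight_cases(4))
  have "real q ^ 3 / (real q - 1) \<in> sum_weight n y ` vecs R 3"
    unfolding 1[symmetric] using x by (rule imageI)
  moreover have "real q ^ 2 \<in> sum_weight n y ` vecs R 3"
    unfolding 2[symmetric] using x'(1) by (rule imageI)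
  ultimately show "w \<in> sum_weight n y ` vecs R 3 - {0}"
    using w weights_distinct(2,3) by auto
qed

end

section \<open>Matrices and the action of a Singer cycle\<close>

lemma mats_row [simp, intro]: "A \<in> mats R m n \<Longrightarrow> i < m \<Longrightarrow> A i \<in> vecs R n"
  by (auto simp: mats_def vecs_def)

lemma mats_entry [simp, intro]: "A \<in> mats R m n \<Longrightarrow> i < m \<Longrightarrow> j < n \<Longrightarrow> A i j \<in> carrier R"
  using vecs_apply[OF mats_row] .

lemma mats_col [simp, intro]: "A \<in> mats R m n \<Longrightarrow> j < n \<Longrightarrow> mat_col m A j \<in> vecs R m"
  unfolding mat_col_def by (rule restrict_vecs) auto

lemma matsI: "(\<And>i. i < m \<Longrightarrow> f i \<in> vecs R n) \<Longrightarrow> restrict f {..<m} \<in> mats R m n"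
  by (auto simp: mats_def vecs_def)

lemma mats_eqI:
  assumes "A \<in> mats R m n" "B \<in> mats R m n" "\<And>i j. i < m \<Longrightarrow> j < n \<Longrightarrow> A i j = B i j"
  shows "A = B"
proof -
  have "A i = B i" if "i < m" for i
    by (rule vecs_eqI[OF mats_row[OF assms(1) that] mats_row[OF assms(2) that]]) (rule assms(3)[OF that])
  then show ?thesis using assms(1,2) unfolding mats_def by (intro PiE_ext) auto
qed

context ring
begin

lemma finsum_swap:
  "(\<And>i j. i < m \<Longrightarrow> j < n \<Longrightarrow> f i j \<in> carrier R)
    \<Longrightarrow> (\<Oplus>i\<in>{..<m::nat}. \<Oplus>j\<in>{..<n::nat}. f i j) = (\<Oplus>j\<in>{..<n}. \<Oplus>i\<in>{..<m}. f i j)"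
proof (induction m)
  case (Suc m)
  have "(\<Oplus>i\<in>{..<Suc m}. \<Oplus>j\<in>{..<n}. f i j) = (\<Oplus>j\<in>{..<n}. f m j) \<oplus> (\<Oplus>i\<in>{..<m}. \<Oplus>j\<in>{..<n}. f i j)"
    unfolding lessThan_Suc by (rule finsum_insert) (auto intro!: finsum_closed Suc.prems)
  also have "\<dots> = (\<Oplus>j\<in>{..<n}. f m j) \<oplus> (\<Oplus>j\<in>{..<n}. \<Oplus>i\<in>{..<m}. f i j)"
    using Suc by simp
  also have "\<dots> = (\<Oplus>j\<in>{..<n}. f m j \<oplus> (\<Oplus>i\<in>{..<m}. f i j))"
    by (rule finsum_addf[symmetric]) (auto intro!: finsum_closed Suc.prems)
  also have "\<dots> = (\<Oplus>j\<in>{..<n}. \<Oplus>i\<in>{..<Suc m}. f i j)"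
    unfolding lessThan_Suc
    by (rule finsum_cong') (auto intro!: finsum_closed finsum_insert[symmetric] a_closed Suc.prems)
  finally show ?case .
qed simp

lemma vec_mat_apply: "j < n \<Longrightarrow> A \<in> mats R m n \<Longrightarrow> x \<in> vecs R m \<Longrightarrow> vec_mat R m n x A j = dot R m x (mat_col m A j)"
  unfolding vec_mat_def dot_def by (auto intro!: finsum_cong' simp: mat_col_def vecs_apply[of x R m])

lemma vec_mat_closed [simp, intro]: "A \<in> mats R m n \<Longrightarrow> x \<in> vecs R m \<Longrightarrow> vec_mat R m n x A \<in> vecs R n"
  unfolding vec_mat_def by (rule restrict_vecs) (auto intro!: finsum_closed simp: vecs_apply[of x R m])

lemma mat_vec_apply: "i < n \<Longrightarrow> mat_vec R n A x i = dot R n (A i) x"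
  by (simp add: mat_vec_def dot_def)

lemma mat_vec_closed [simp, intro]: "A \<in> mats R n n \<Longrightarrow> x \<in> vecs R n \<Longrightarrow> mat_vec R n A x \<in> vecs R n"
  unfolding mat_vec_def by (rule restrict_vecs) (auto intro!: finsum_closed simp: vecs_apply[of x R n])

lemma mat_vec_rsmult:
  assumes "A \<in> mats R n n" "x \<in> vecs R n" "r \<in> carrier R"
  shows "mat_vec R n A (vec_rsmult R n x r) = vec_rsmult R n (mat_vec R n A x) r"
proof (rule vecs_eqI)
  fix i assume "i < n"
  then show "mat_vec R n A (vec_rsmult R n x r) i = vec_rsmult R n (mat_vec R n A x) r i"
    using assms dot_rsmult[of r "A i" n x] by (simp add: mat_vec_apply) (simp add: vec_rsmult_def mat_vec_apply)
qed (use assms in auto)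

text \<open>  The identity \<open>(x A) y = x (A y)\<close>, to which the associativity of matrix multiplication and the
  compatibility of that multiplication with the action on vectors both reduce, row by row.\<close>

lemma dot_vec_mat:
  assumes x: "x \<in> vecs R m" and A: "A \<in> mats R m n" and y: "y \<in> vecs R n"
  shows "dot R n (vec_mat R m n x A) y = dot R m x (\<lambda>i\<in>{..<m}. dot R n (A i) y)"
proof -
  have cx: "x i \<in> carrier R" if "i < m" for i using that x by auto
  have cA: "A i j \<in> carrier R" if "i < m" "j < n" for i j using that A by auto
  have cy: "y j \<in> carrier R" if "j < n" for j using that y by auto
  have "dot R n (vec_mat R m n x A) y = (\<Oplus>j\<in>{..<n}. \<Oplus>i\<in>{..<m}. x i \<otimes> A i j \<otimes> y j)"
    unfolding dot_def
  proof (rule finsum_cong')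
    fix j assume j: "j \<in> {..<n}"
    have "vec_mat R m n x A j \<otimes> y j = (\<Oplus>i\<in>{..<m}. x i \<otimes> A i j) \<otimes> y j"
      using j by (simp add: vec_mat_def)
    also have "\<dots> = (\<Oplus>i\<in>{..<m}. x i \<otimes> A i j \<otimes> y j)"
      using j cx cA cy by (intro finsum_ldistr) auto
    finally show "vec_mat R m n x A j \<otimes> y j = (\<Oplus>i\<in>{..<m}. x i \<otimes> A i j \<otimes> y j)" .
  qed (auto intro!: finsum_closed m_closed cx cA cy)
  also have "\<dots> = (\<Oplus>i\<in>{..<m}. \<Oplus>j\<in>{..<n}. x i \<otimes> A i j \<otimes> y j)"
    by (rule finsum_swap) (intro m_closed cx cA cy)
  also have "\<dots> = dot R m x (\<lambda>i\<in>{..<m}. dot R n (A i) y)"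
    unfolding dot_def
  proof (rule finsum_cong')
    fix i assume i: "i \<in> {..<m}"
    have "(\<Oplus>j\<in>{..<n}. x i \<otimes> A i j \<otimes> y j) = (\<Oplus>j\<in>{..<n}. x i \<otimes> (A i j \<otimes> y j))"
      using i cx cA cy by (intro finsum_cong') (auto simp: m_assoc)
    also have "\<dots> = x i \<otimes> (\<Oplus>j\<in>{..<n}. A i j \<otimes> y j)"
      using i cx cA cy by (intro finsum_rdistr[symmetric]) auto
    finally show "(\<Oplus>j\<in>{..<n}. x i \<otimes> A i j \<otimes> y j)
        = x i \<otimes> (\<lambda>i\<in>{..<m}. \<Oplus>j\<in>{..<n}. A i j \<otimes> y j) i" using i by simp
  qed (auto intro!: finsum_closed m_closed cx cA cy)
  finally show ?thesis .
qed

abbreviation mat_mult :: "nat \<Rightarrow> (nat \<Rightarrow> nat \<Rightarrow> 'a) \<Rightarrow> (nat \<Rightarrow> nat \<Rightarrow> 'a) \<Rightarrow> nat \<Rightarrow> nat \<Rightarrow> 'a" where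
  "mat_mult n \<equiv> monoid.mult (mat_monoid R n)"

lemma mat_monoid_simps:
  "carrier (mat_monoid R n) = mats R n n"
  "\<one>\<^bsub>mat_monoid R n\<^esub> = scalar_mat R n \<one>"
  "mat_mult n A B = (\<lambda>i\<in>{..<n}. vec_mat R n n (A i) B)"
  by (simp_all add: mat_monoid_def vec_mat_def)

lemma mat_mult_closed: "A \<in> mats R n n \<Longrightarrow> B \<in> mats R n n \<Longrightarrow> mat_mult n A B \<in> mats R n n"
  unfolding mat_monoid_simps by (rule matsI) auto

lemma mat_vec_mult:
  assumes "A \<in> mats R n n" "B \<in> mats R n n" "x \<in> vecs R n"
  shows "mat_vec R n (mat_mult n A B) x = mat_vec R n A (mat_vec R n B x)"
proof (rule vecs_eqI)
  show "mat_vec R n (mat_mult n A B) x \<in> vecs R n" using assms mat_mult_closed by blast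
  fix i assume i: "i < n"
  have *: "(\<lambda>i\<in>{..<n}. dot R n (B i) x) = mat_vec R n B x"
    by (simp add: mat_vec_def dot_def)
  show "mat_vec R n (mat_mult n A B) x i = mat_vec R n A (mat_vec R n B x) i"
    using i assms dot_vec_mat[of "A i" n B n x] unfolding * by (simp add: mat_vec_apply mat_monoid_simps)
qed (use assms in auto)

lemma scalar_mat_closed [simp, intro]: "a \<in> carrier R \<Longrightarrow> scalar_mat R n a \<in> mats R n n"
  unfolding scalar_mat_def by (intro matsI restrict_vecs) auto

lemma scalar_mat_row: "i < n \<Longrightarrow> scalar_mat R n a i = coord_vec n i a"
  by (auto simp: scalar_mat_def coord_vec_def fun_eq_iff)

lemma scalar_mat_col: "j < n \<Longrightarrow> mat_col n (scalar_mat R n a) j = coord_vec n j a"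
  by (auto simp: scalar_mat_def coord_vec_def mat_col_def fun_eq_iff)

lemma scalar_mult_entry:
  assumes "A \<in> mats R n n" "a \<in> carrier R" "i < n" "j < n"
  shows "mat_mult n (scalar_mat R n a) A i j = a \<otimes> A i j" "mat_mult n A (scalar_mat R n a) i j = A i j \<otimes> a"
proof -
  show "mat_mult n (scalar_mat R n a) A i j = a \<otimes> A i j"
    using assms by (simp add: mat_monoid_simps vec_mat_apply scalar_mat_row dot_coord_left)
      (simp add: mat_col_def)
  show "mat_mult n A (scalar_mat R n a) i j = A i j \<otimes> a"
    using assms mats_row[OF assms(1,3)] by (simp add: mat_monoid_simps vec_mat_apply scalar_mat_col dot_coord_right)
qed

lemma mat_col_mult:
  assumes "A \<in> mats R n n" "B \<in> mats R n n" "j < n"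
  shows "mat_col n (mat_mult n A B) j = mat_vec R n A (mat_col n B j)"
proof (rule vecs_eqI)
  show "mat_col n (mat_mult n A B) j \<in> vecs R n" using assms mat_mult_closed by blast
  fix i assume "i < n"
  then show "mat_col n (mat_mult n A B) j i = mat_vec R n A (mat_col n B j) i"
    using assms mats_row[OF assms(1) \<open>i < n\<close>]
    by (simp add: mat_vec_apply vec_mat_apply[symmetric]) (simp add: mat_col_def mat_monoid_simps)
qed (use assms in auto)

lemma mat_monoid: "Group.monoid (mat_monoid R n)"
proof (rule monoidI; unfold mat_monoid_simps(1,2))
  fix A B C assume A: "A \<in> mats R n n" "B \<in> mats R n n" "C \<in> mats R n n"
  show "mat_mult n A B \<in> mats R n n" using A(1,2) by (rule mat_mult_closed)
  show "mat_mult n (mat_mult n A B) C = mat_mult n A (mat_mult n B C)"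
  proof (rule mats_eqI[of _ R n n])
    fix i j assume ij: "i < n" "j < n"
    have "mat_mult n (mat_mult n A B) C i j = dot R n (mat_mult n A B i) (mat_col n C j)"
      using ij A mat_mult_closed[OF A(1,2)] by (subst mat_monoid_simps(3)) (simp add: vec_mat_apply)
    also have "\<dots> = mat_vec R n (mat_mult n A B) (mat_col n C j) i"
      using ij by (simp add: mat_vec_apply)
    also have "\<dots> = mat_vec R n A (mat_col n (mat_mult n B C) j) i"
      using ij A by (simp add: mat_vec_mult mat_col_mult)
    also have "\<dots> = mat_mult n A (mat_mult n B C) i j"
      using ij A mat_mult_closed[OF A(2,3)] by (subst (2) mat_monoid_simps(3)) (simp add: vec_mat_apply mat_vec_apply)
    finally show "mat_mult n (mat_mult n A B) C i j = mat_mult n A (mat_mult n B C) i j" .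
  qed (use A mat_mult_closed in auto)
next
  fix A assume A: "A \<in> mats R n n"
  show "mat_mult n (scalar_mat R n \<one>) A = A" "mat_mult n A (scalar_mat R n \<one>) = A"
    using A by (intro mats_eqI[of _ R n n]; simp add: scalar_mult_entry mat_mult_closed)+
qed auto

lemma right_span_image: "right_span R n x = vec_rsmult R n x ` carrier R"
  by (auto simp: right_span_def)

lemma right_span_self: "x \<in> vecs R n \<Longrightarrow> x \<in> right_span R n x"
  unfolding right_span_image by (intro image_eqI[OF _ one_closed]) (simp add: vec_rsmult_one)

lemma mat_act_right_span:
  assumes "A \<in> mats R n n" "x \<in> vecs R n"
  shows "mat_act R n A (right_span R n x) = right_span R n (mat_vec R n A x)"
  unfolding mat_act_def right_span_image image_image
  by (rule image_cong) (simp_all add: mat_vec_rsmult assms)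

end

context field
begin

lemma GL_group: "group (GL R n)"
  unfolding GL_def using mat_monoid by (rule monoid.units_group)

lemma GL_simps: "carrier (GL R n) = Units (mat_monoid R n)" "monoid.mult (GL R n) = mat_mult n"
  "\<one>\<^bsub>GL R n\<^esub> = scalar_mat R n \<one>"
  by (simp_all add: GL_def units_of_def mat_monoid_simps)

lemma GL_mats: "A \<in> carrier (GL R n) \<Longrightarrow> A \<in> mats R n n"
  by (simp add: GL_simps Units_def mat_monoid_simps(1))

lemma scalar_mat_commute:
  "A \<in> mats R n n \<Longrightarrow> a \<in> carrier R \<Longrightarrow> mat_mult n (scalar_mat R n a) A = mat_mult n A (scalar_mat R n a)"
  by (rule mats_eqI[of _ R n n]) (auto simp: scalar_mult_entry mat_mult_closed m_comm)

lemma scalar_mat_mult: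
  assumes "a \<in> carrier R" "b \<in> carrier R"
  shows "mat_mult n (scalar_mat R n a) (scalar_mat R n b) = scalar_mat R n (a \<otimes> b)"
proof (rule mats_eqI[of _ R n n])
  fix i j assume "i < n" "j < n"
  then show "mat_mult n (scalar_mat R n a) (scalar_mat R n b) i j = scalar_mat R n (a \<otimes> b) i j"
    using assms by (simp add: scalar_mult_entry) (simp add: scalar_mat_def)
qed (use assms mat_mult_closed in auto)

lemma nonzero_inverse:
  assumes "a \<in> carrier R - {\<zero>}"
  shows "inv a \<in> carrier R - {\<zero>}" "inv a \<otimes> a = \<one>" "a \<otimes> inv a = \<one>"
  using assms field_Units Units_inv_Units Units_l_inv Units_r_inv by auto

lemma scalar_mat_GL: "a \<in> carrier R - {\<zero>} \<Longrightarrow> scalar_mat R n a \<in> carrier (GL R n)"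
  using nonzero_inverse[of a] unfolding GL_simps Units_def mat_monoid_simps(1,2)
  by (auto intro!: bexI[of _ "scalar_mat R n (inv a)"] simp: scalar_mat_mult)

lemma scalar_mats_normal: "scalar_mats R n \<lhd> GL R n"
proof -
  interpret G: group "GL R n" by (rule GL_group)
  have "subgroup (scalar_mats R n) (GL R n)"
  proof (rule G.subgroupI)
    show "scalar_mats R n \<subseteq> carrier (GL R n)" by (auto simp: scalar_mats_def intro!: scalar_mat_GL)
    have "scalar_mat R n \<one> \<in> scalar_mats R n" unfolding scalar_mats_def using one_not_zero by blast
    then show "scalar_mats R n \<noteq> {}" by blast
    fix A B assume "A \<in> scalar_mats R n"
    then obtain a where a: "a \<in> carrier R - {\<zero>}" "A = scalar_mat R n a" by (auto simp: scalar_mats_def)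
    have "inv\<^bsub>GL R n\<^esub> A = scalar_mat R n (inv a)"
      using a nonzero_inverse[OF a(1)] scalar_mat_GL
      by (intro G.inv_equality) (auto simp: GL_simps(2,3) scalar_mat_mult)
    then show "inv\<^bsub>GL R n\<^esub> A \<in> scalar_mats R n"
      using nonzero_inverse(1)[OF a(1)] unfolding scalar_mats_def by blast
    assume "B \<in> scalar_mats R n"
    then obtain b where b: "b \<in> carrier R - {\<zero>}" "B = scalar_mat R n b" by (auto simp: scalar_mats_def)
    have "a \<otimes> b \<in> carrier R - {\<zero>}" using a b integral_iff by auto
    moreover have "A \<otimes>\<^bsub>GL R n\<^esub> B = scalar_mat R n (a \<otimes> b)"
      using a b by (simp add: GL_simps scalar_mat_mult)
    ultimately show "A \<otimes>\<^bsub>GL R n\<^esub> B \<in> scalar_mats R n" unfolding scalar_mats_def by blast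
  qed
  moreover have "\<forall>A\<in>carrier (GL R n). scalar_mats R n #>\<^bsub>GL R n\<^esub> A = A <#\<^bsub>GL R n\<^esub> scalar_mats R n"
    by (auto simp: r_coset_def l_coset_def GL_simps(2) scalar_mats_def scalar_mat_commute[OF GL_mats])
  ultimately show ?thesis by (rule G.normalI)
qed

text \<open>  The projection to the factor group is a homomorphism, so the subgroup generated by the class of
  \<open>S\<close> consists of the classes of the powers of \<open>S\<close>. This needs that the scalar matrices are normal.\<close>

lemma generate_PGL:
  assumes "S \<in> carrier (GL R n)"
  shows "generate (PGL R n) {scalar_mats R n #>\<^bsub>GL R n\<^esub> S}
    = (\<lambda>A. scalar_mats R n #>\<^bsub>GL R n\<^esub> A) ` generate (GL R n) {S}"
proof -
  interpret N: normal "scalar_mats R n" "GL R n" by (rule scalar_mats_normal)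
  interpret h: group_hom "GL R n" "PGL R n" "\<lambda>A. scalar_mats R n #>\<^bsub>GL R n\<^esub> A"
    unfolding PGL_def
    by (intro group_hom.intro group_hom_axioms.intro GL_group N.factorgroup_is_group N.r_coset_hom_Mod)
  show ?thesis using h.generate_img[of "{S}"] assms by simp
qed

lemma right_span_scalar:
  assumes x: "x \<in> vecs R n" and c: "c \<in> carrier R - {\<zero>}"
  shows "right_span R n (vec_rsmult R n x c) = right_span R n x"
proof -
  note c' = nonzero_inverse[OF c]
  show ?thesis unfolding right_span_image
  proof (intro equalityI subsetI; elim imageE)
    fix w r assume w: "w = vec_rsmult R n (vec_rsmult R n x c) r" and r: "r \<in> carrier R"
    have "w = vec_rsmult R n x (c \<otimes> r)" unfolding w using x c r by (simp add: vec_rsmult_assoc)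
    moreover have "c \<otimes> r \<in> carrier R" using c r by simp
    ultimately show "w \<in> vec_rsmult R n x ` carrier R" by (rule image_eqI)
  next
    fix w r assume w: "w = vec_rsmult R n x r" and r: "r \<in> carrier R"
    have "w = vec_rsmult R n (vec_rsmult R n x c) (inv c \<otimes> r)"
      unfolding w using r x c c' by (simp add: vec_rsmult_assoc m_assoc[symmetric])
    moreover have "inv c \<otimes> r \<in> carrier R" using c' r by simp
    ultimately show "w \<in> vec_rsmult R n (vec_rsmult R n x c) ` carrier R" by (rule image_eqI)
  qed
qed

lemma mat_vec_scalar:
  assumes "x \<in> vecs R n" "c \<in> carrier R"
  shows "mat_vec R n (scalar_mat R n c) x = vec_rsmult R n x c"
proof (rule vecs_eqI)
  fix i assume "i < n"
  then show "mat_vec R n (scalar_mat R n c) x i = vec_rsmult R n x c i"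
    using assms by (simp add: mat_vec_apply scalar_mat_row dot_coord_left)
      (simp add: vec_rsmult_def m_comm vecs_apply[of x R n])
qed (use assms in auto)

text \<open>  The matrices in a coset of the scalar matrices move a point to the same image, so the union in the
  definition of the action is the image under any one of them.\<close>

lemma PGL_act_coset:
  assumes A: "A \<in> mats R n n" and x: "x \<in> vecs R n"
  shows "PGL_act R n (scalar_mats R n #>\<^bsub>GL R n\<^esub> A) (right_span R n x) = mat_act R n A (right_span R n x)"
proof -
  have "mat_act R n (mat_mult n (scalar_mat R n c) A) (right_span R n x) = mat_act R n A (right_span R n x)"
    if c: "c \<in> carrier R - {\<zero>}" for c
    using c A x by (simp add: mat_act_right_span mat_mult_closed mat_vec_mult mat_vec_scalar right_span_scalar)
  moreover have "\<one> \<in> carrier R - {\<zero>}" by simp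
  ultimately show ?thesis
    unfolding PGL_act_def r_coset_def GL_simps(2) scalar_mats_def by blast
qed

lemma singer_cycle_transitive:
  assumes singer: "singer_cycle R C" and S: "S \<in> carrier (GL R 3)"
    and C: "C = generate (PGL R 3) {scalar_mats R 3 #>\<^bsub>GL R 3\<^esub> S}"
    and x: "x \<in> vecs R 3" "x \<noteq> vec_zero R 3" and v: "v \<in> vecs R 3" "v \<noteq> vec_zero R 3"
  shows "\<exists>A\<in>generate (GL R 3) {S}. A \<in> mats R 3 3 \<and> mat_act R 3 A (right_span R 3 x) = right_span R 3 v"
proof -
  have "right_span R 3 x \<in> PG_points R 3" "right_span R 3 v \<in> PG_points R 3"
    using x v by (auto simp: PG_points_def)
  then obtain g where g: "g \<in> C" "PGL_act R 3 g (right_span R 3 x) = right_span R 3 v"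
    using singer unfolding singer_cycle_def by blast
  then obtain A where A: "A \<in> generate (GL R 3) {S}" "g = scalar_mats R 3 #>\<^bsub>GL R 3\<^esub> A"
    unfolding C generate_PGL[OF S] by blast
  have "A \<in> mats R 3 3"
    using group.generate_in_carrier[OF GL_group _ A(1)] S GL_mats by blast
  then show ?thesis using A g PGL_act_coset x by auto
qed

end

section \<open>Hyperplanes and codes generated by rows\<close>

lemma mat_col_apply [simp]: "i < m \<Longrightarrow> mat_col m A j i = A i j"
  by (simp add: mat_col_def)

context ring
begin

definition dot_form :: "nat \<Rightarrow> (nat \<Rightarrow> 'a) \<Rightarrow> (nat \<Rightarrow> 'a) \<Rightarrow> 'a" where
  "dot_form n x = (\<lambda>y\<in>vecs R n. dot R n x y)"

lemma dot_form_right_form: "x \<in> vecs R n \<Longrightarrow> dot_form n x \<in> right_forms R n"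
  by (auto simp: right_forms_def dot_form_def dot_add_right dot_rsmult)

lemma form_span_self:
  assumes "\<phi> \<in> right_forms R n"
  shows "\<phi> \<in> form_span R n \<phi>"
proof -
  have E: "\<phi> \<in> vecs R n \<rightarrow>\<^sub>E carrier R" using assms by (simp add: right_forms_def)
  have "\<phi> = (\<lambda>x\<in>vecs R n. \<one> \<otimes> \<phi> x)"
  proof (rule PiE_ext[OF E])
    show "(\<lambda>x\<in>vecs R n. \<one> \<otimes> \<phi> x) \<in> vecs R n \<rightarrow>\<^sub>E carrier R"
      by (rule restrict_PiE_iff[THEN iffD2]) (use PiE_mem[OF E] in simp)
    show "\<phi> x = (\<lambda>x\<in>vecs R n. \<one> \<otimes> \<phi> x) x" if "x \<in> vecs R n" for x
      using PiE_mem[OF E that] that by simp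
  qed
  then show ?thesis unfolding form_span_def using one_closed by blast
qed

text \<open>  Incidence is defined through some generator of the point and some generator of the hyperplane. Any
  other generators are multiples \<open>xr\<close> and \<open>s\<psi>\<close> of these, and \<open>(s\<psi>)(xr) = s \<psi>(x) r\<close>; so
  incidence may be tested on arbitrary generators.\<close>

lemma lies_on_iff:
  assumes y: "y \<in> vecs R n" and \<phi>: "\<phi> \<in> right_forms R n"
  shows "lies_on R n (right_span R n y) (form_span R n \<phi>) \<longleftrightarrow> \<phi> y = \<zero>"
proof
  assume "\<phi> y = \<zero>"
  then show "lies_on R n (right_span R n y) (form_span R n \<phi>)"
    using y \<phi> unfolding lies_on_def by blast
next
  assume "lies_on R n (right_span R n y) (form_span R n \<phi>)"
  then obtain x \<psi> where x: "x \<in> vecs R n" "right_span R n y = right_span R n x"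
    and \<psi>: "\<psi> \<in> right_forms R n" "form_span R n \<phi> = form_span R n \<psi>" and zero: "\<psi> x = \<zero>"
    unfolding lies_on_def by (elim bexE conjE)
  have "y \<in> right_span R n x" using right_span_self[OF y] unfolding x(2) .
  then obtain r where r: "r \<in> carrier R" "y = vec_rsmult R n x r"
    unfolding right_span_image by (elim imageE)
  have "\<phi> \<in> form_span R n \<psi>" using form_span_self[OF \<phi>] unfolding \<psi>(2) .
  then obtain s where s: "s \<in> carrier R" "\<phi> = (\<lambda>x\<in>vecs R n. s \<otimes> \<psi> x)"
    unfolding form_span_def by (elim CollectE exE conjE)
  have "\<psi> (vec_rsmult R n x r) = \<psi> x \<otimes> r" using \<psi>(1) x(1) r(1) by (simp add: right_forms_def)
  then have "\<psi> y = \<zero>" using r by (simp add: zero)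
  then show "\<phi> y = \<zero>" using s y by simp
qed

lemma vec_mat_add:
  assumes A: "A \<in> mats R m n" and x: "x \<in> vecs R m" "x' \<in> vecs R m"
  shows "vec_mat R m n (vec_add R m x x') A = vec_add R n (vec_mat R m n x A) (vec_mat R m n x' A)"
proof (rule vecs_eqI[OF vec_mat_closed[OF A vec_add_closed[OF x]]
      vec_add_closed[OF vec_mat_closed[OF A x(1)] vec_mat_closed[OF A x(2)]]])
  fix j assume j: "j < n"
  note entry = vec_mat_apply[OF j A]
  show "vec_mat R m n (vec_add R m x x') A j = vec_add R n (vec_mat R m n x A) (vec_mat R m n x' A) j"
    using j by (simp add: vec_add_def[of R n] entry[OF vec_add_closed[OF x]] entry[OF x(1)] entry[OF x(2)]
        dot_add_left[OF x mats_col[OF A j]])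
qed

lemma vec_mat_lsmult:
  assumes A: "A \<in> mats R m n" and x: "x \<in> vecs R m" and r: "r \<in> carrier R"
  shows "vec_mat R m n (vec_lsmult R m r x) A = vec_lsmult R n r (vec_mat R m n x A)"
proof (rule vecs_eqI[OF vec_mat_closed[OF A vec_lsmult_closed[OF r x]] vec_lsmult_closed[OF r vec_mat_closed[OF A x]]])
  fix j assume j: "j < n"
  note entry = vec_mat_apply[OF j A]
  show "vec_mat R m n (vec_lsmult R m r x) A j = vec_lsmult R n r (vec_mat R m n x A) j"
    using j by (simp add: vec_lsmult_def[of R n] entry[OF vec_lsmult_closed[OF r x]] entry[OF x]
        dot_lsmult[OF r x mats_col[OF A j]])
qed

lemma vec_mat_zero:
  assumes A: "A \<in> mats R m n"
  shows "vec_mat R m n (vec_zero R m) A = vec_zero R n"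
proof (rule vecs_eqI[OF vec_mat_closed[OF A vec_zero_closed] vec_zero_closed])
  fix j assume j: "j < n"
  show "vec_mat R m n (vec_zero R m) A j = vec_zero R n j"
    using j by (simp add: vec_mat_apply[OF j A vec_zero_closed] dot_zero_left[OF mats_col[OF A j]])
      (simp add: vec_zero_def)
qed

lemma vec_mat_coord:
  assumes A: "A \<in> mats R m n" and i: "i < m" and a: "a \<in> carrier R"
  shows "vec_mat R m n (coord_vec m i a) A = vec_lsmult R n a (A i)"
proof (rule vecs_eqI[OF vec_mat_closed[OF A coord_vec_closed[OF a]] vec_lsmult_closed[OF a mats_row[OF A i]]])
  fix j assume j: "j < n"
  show "vec_mat R m n (coord_vec m i a) A j = vec_lsmult R n a (A i) j"
    using i j by (simp add: vec_mat_apply[OF j A coord_vec_closed[OF a]] dot_coord_left[OF mats_col[OF A j] i a]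
        vec_lsmult_def)
qed

lemma left_linear_row_code:
  assumes A: "A \<in> mats R m n"
  shows "left_linear_code R n (row_code R m n A)"
  unfolding left_linear_code_def
proof (intro conjI ballI)
  show "row_code R m n A \<subseteq> vecs R n" using A by (auto simp: row_code_def)
  show "vec_zero R n \<in> row_code R m n A"
    unfolding row_code_def using vec_mat_zero[OF A] vec_zero_closed[of m] by (metis (mono_tags, lifting) CollectI)
next
  fix c d assume "c \<in> row_code R m n A" "d \<in> row_code R m n A"
  then obtain x x' where x: "x \<in> vecs R m" "c = vec_mat R m n x A" "x' \<in> vecs R m" "d = vec_mat R m n x' A"
    unfolding row_code_def by blast
  have "vec_add R n c d = vec_mat R m n (vec_add R m x x') A"
    using vec_mat_add[OF A x(1,3)] x(2,4) by simp
  then show "vec_add R n c d \<in> row_code R m n A"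
    unfolding row_code_def using vec_add_closed[OF x(1,3)] by blast
next
  fix r c assume r: "r \<in> carrier R" and "c \<in> row_code R m n A"
  then obtain x where x: "x \<in> vecs R m" "c = vec_mat R m n x A"
    unfolding row_code_def by blast
  have "vec_lsmult R n r c = vec_mat R m n (vec_lsmult R m r x) A"
    using vec_mat_lsmult[OF A x(1) r] x(2) by simp
  then show "vec_lsmult R n r c \<in> row_code R m n A"
    unfolding row_code_def using vec_lsmult_closed[OF r x(1)] by blast
qed

lemma row_code_subset:
  assumes A: "A \<in> mats R m n" and D: "left_linear_code R n D" "\<And>i. i < m \<Longrightarrow> A i \<in> D"
  shows "row_code R m n A \<subseteq> D"
proof
  fix c assume "c \<in> row_code R m n A"
  then obtain x where x: "x \<in> vecs R m" "c = vec_mat R m n x A" unfolding row_code_def by blast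
  have cx: "x i \<in> carrier R" if "i < m" for i using that x(1) by auto
  have zero: "vec_zero R n \<in> D"
    and add: "\<And>c d. c \<in> D \<Longrightarrow> d \<in> D \<Longrightarrow> vec_add R n c d \<in> D"
    and lsmult: "\<And>r c. r \<in> carrier R \<Longrightarrow> c \<in> D \<Longrightarrow> vec_lsmult R n r c \<in> D"
    using D(1) by (simp_all add: left_linear_code_def)
  have "(\<lambda>j\<in>{..<n}. \<Oplus>i\<in>{..<k}. x i \<otimes> A i j) \<in> D" if "k \<le> m" for k
    using that
  proof (induction k)
    case 0
    show ?case using zero unfolding vec_zero_def by (simp only: lessThan_0 finsum_empty)
  next
    case (Suc k)
    have "(\<lambda>j\<in>{..<n}. \<Oplus>i\<in>{..<Suc k}. x i \<otimes> A i j)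
        = vec_add R n (vec_lsmult R n (x k) (A k)) (\<lambda>j\<in>{..<n}. \<Oplus>i\<in>{..<k}. x i \<otimes> A i j)"
      unfolding lessThan_Suc vec_add_def vec_lsmult_def
    proof (rule restrict_ext)
      fix j assume j: "j \<in> {..<n}"
      have "x i \<otimes> A i j \<in> carrier R" if "i < Suc k" for i
        using that Suc.prems j cx[of i] mats_entry[OF A, of i j] by simp
      then show "(\<Oplus>i\<in>insert k {..<k}. x i \<otimes> A i j)
          = (\<lambda>i\<in>{..<n}. x k \<otimes> A k i) j \<oplus> (\<lambda>j\<in>{..<n}. \<Oplus>i\<in>{..<k}. x i \<otimes> A i j) j"
        using j by (simp add: finsum_insert Pi_def)
    qed
    moreover have "vec_lsmult R n (x k) (A k) \<in> D"
      using Suc.prems by (intro lsmult cx D(2)) simp_all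
    moreover have "(\<lambda>j\<in>{..<n}. \<Oplus>i\<in>{..<k}. x i \<otimes> A i j) \<in> D"
      using Suc.prems by (intro Suc.IH) simp
    ultimately show ?case by (simp only: add)
  qed
  from this[of m] show "c \<in> D" by (simp add: x(2) vec_mat_def)
qed

lemma k_generated_row_code:
  assumes A: "A \<in> mats R m n" and inj: "inj_on A {..<m}"
  shows "k_generated_code R n m (row_code R m n A)"
proof -
  have row: "A i \<in> row_code R m n A" if "i < m" for i
  proof -
    have "A i = vec_mat R m n (coord_vec m i \<one>) A"
      unfolding vec_mat_coord[OF A that one_closed]
      using mats_row[OF A that] by (intro vecs_eqI[of _ R n]) (auto simp: vec_lsmult_def)
    then show ?thesis unfolding row_code_def using coord_vec_closed[OF one_closed] by blast
  qed
  then have rows: "A ` {..<m} \<subseteq> row_code R m n A" by auto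
  have "row_code R m n A = \<Inter>{D. left_linear_code R n D \<and> A ` {..<m} \<subseteq> D}"
  proof (intro equalityI Inter_greatest Inter_lower)
    show "row_code R m n A \<subseteq> D" if "D \<in> {D. left_linear_code R n D \<and> A ` {..<m} \<subseteq> D}" for D
      using that by (intro row_code_subset[OF A]) auto
    show "row_code R m n A \<in> {D. left_linear_code R n D \<and> A ` {..<m} \<subseteq> D}"
      using left_linear_row_code[OF A] rows by simp
  qed
  moreover have "card (A ` {..<m}) = m" using card_image[OF inj] by simp
  ultimately show ?thesis unfolding k_generated_code_def using rows by (intro exI[of _ "A ` {..<m}"]) simp
qed

end

context chain_ring_of_length_two
begin

text \<open>  If all coordinates of \<open>x\<close> were in the radical, then \<open>x X = 0\<close>, and applying \<open>\<phi>\<close> would give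
  \<open>X = \<phi>(x) X = \<phi>(x X) = 0\<close>.\<close>

lemma unimodular_residue:
  assumes x: "x \<in> vecs R m" and \<phi>: "\<phi> \<in> right_forms R m" "\<phi> x = \<one>"
  shows "residue_vec m x \<noteq> vec_zero F m"
proof
  assume zero: "residue_vec m x = vec_zero F m"
  have "x i \<otimes> \<tau> \<one>\<^bsub>F\<^esub> = \<zero>" if "i < m" for i
    using fun_cong[OF zero, of i] that x by (simp add: vec_zero_def mult_rad vecs_apply[of x R m])
  then have *: "vec_rsmult R m x (\<tau> \<one>\<^bsub>F\<^esub>) = vec_rsmult R m x \<zero>"
    using x by (intro vecs_eqI[of _ R m]) (auto simp: vec_rsmult_def)
  have lin: "\<phi> (vec_rsmult R m x r) = \<one> \<otimes> r" if "r \<in> carrier R" for r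
    using \<phi> x that unfolding right_forms_def by auto
  have "\<one> \<otimes> \<tau> \<one>\<^bsub>F\<^esub> = \<one> \<otimes> \<zero>"
    unfolding lin[OF rad_closed[OF F.one_closed], symmetric] lin[OF R.zero_closed, symmetric] * ..
  then show False by simp
qed

lemma card_points_on_hyperplane:
  assumes y: "\<And>j. j < n \<Longrightarrow> y j \<in> vecs R 3"
    and bij: "bij_betw (\<lambda>j. right_span R 3 (y j)) {..<n} K"
    and H: "\<And>H. H \<in> barbilian_hyperplanes R 3 \<Longrightarrow> card {P \<in> K. lies_on R 3 P H} \<in> M"
    and x: "x \<in> vecs R 3" "residue_vec 3 x \<noteq> vec_zero F 3"
  shows "card (zeros n y x) \<in> M"
proof -
  let ?\<phi> = "R.dot_form 3 x" and ?s = "\<lambda>j. right_span R 3 (y j)"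
  have \<phi>: "?\<phi> \<in> right_forms R 3" using x(1) by (rule R.dot_form_right_form)
  obtain u where u: "u \<in> vecs R 3" "dot R 3 x u = \<one>" using unimodular_vec[OF x] by blast
  then have "?\<phi> u = \<one>" by (simp add: R.dot_form_def)
  then have "form_span R 3 ?\<phi> \<in> barbilian_hyperplanes R 3"
    unfolding barbilian_hyperplanes_def using \<phi> u(1) by blast
  then have "card {P \<in> K. lies_on R 3 P (form_span R 3 ?\<phi>)} \<in> M" by (rule H)
  also have "{P \<in> K. lies_on R 3 P (form_span R 3 ?\<phi>)} = ?s ` zeros n y x"
  proof -
    have "lies_on R 3 (?s j) (form_span R 3 ?\<phi>) \<longleftrightarrow> dot R 3 x (y j) = \<zero>" if "j < n" for j
      using R.lies_on_iff[OF y[OF that] \<phi>] y[OF that] by (simp add: R.dot_form_def)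
    moreover have "K = ?s ` {..<n}" using bij by (simp add: bij_betw_def)
    ultimately show ?thesis unfolding zeros_def by auto
  qed
  also have "card (?s ` zeros n y x) = card (zeros n y x)"
  proof (rule card_image[OF inj_on_subset[OF bij_betw_imp_inj_on[OF bij]]])
    show "zeros n y x \<subseteq> {..<n}" by (auto simp: zeros_def)
  qed
  finally show ?thesis .
qed

text \<open>  One point of the orbit, reduced: if the constant matrix \<open>A\<close> moves the residue of \<open>x\<close> to \<open>v\<close> and its
  lift moves \<open>xR\<close> to \<open>yR\<close>, then the residue of \<open>y\<close> generates the same point as \<open>v\<close>.\<close>

lemma orbit_covers_residue_plane:
  assumes lift: "A \<in> mats F 3 3" "A' \<in> mats R 3 3" "\<And>i k. i < 3 \<Longrightarrow> k < 3 \<Longrightarrow> \<pi> (A' i k) = A i k"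
    and x: "x \<in> vecs R 3"
    and v: "v \<in> vecs F 3" "v \<noteq> vec_zero F 3"
    and A: "mat_act F 3 A (right_span F 3 (residue_vec 3 x)) = right_span F 3 v"
    and y: "y \<in> vecs R 3" "mat_act R 3 A' (right_span R 3 x) = right_span R 3 y"
  shows "\<exists>c\<in>carrier F - {\<zero>\<^bsub>F\<^esub>}. v = vec_rsmult F 3 (residue_vec 3 y) c"
proof -
  have "residue_vec 3 (mat_vec R 3 A' x) i = mat_vec F 3 A (residue_vec 3 x) i" if i: "i < 3" for i
  proof -
    have row: "residue_vec 3 (A' i) = A i"
      by (rule vecs_eqI[OF residue_vec_closed[OF mats_row[OF lift(2) i]] mats_row[OF lift(1) i]])
        (simp add: lift(3) i)
    have "residue_vec 3 (mat_vec R 3 A' x) i = \<pi> (dot R 3 (A' i) x)"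
      using i by (simp add: R.mat_vec_apply)
    also have "\<dots> = dot F 3 (A i) (residue_vec 3 x)"
      using residue_dot[OF mats_row[OF lift(2) i] x] unfolding row .
    also have "\<dots> = mat_vec F 3 A (residue_vec 3 x) i"
      using F.mat_vec_apply[OF i] by (rule sym)
    finally show ?thesis .
  qed
  then have res: "residue_vec 3 (mat_vec R 3 A' x) = mat_vec F 3 A (residue_vec 3 x)"
    by (rule vecs_eqI[OF residue_vec_closed[OF R.mat_vec_closed[OF lift(2) x]]
          F.mat_vec_closed[OF lift(1) residue_vec_closed[OF x]]])
  have "mat_vec R 3 A' x \<in> right_span R 3 y"
    using R.right_span_self[OF R.mat_vec_closed[OF lift(2) x]] y(2)
    by (simp add: R.mat_act_right_span[OF lift(2) x])
  then obtain r where r: "r \<in> carrier R" "mat_vec R 3 A' x = vec_rsmult R 3 y r"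
    unfolding right_span_def by blast
  have Ax: "mat_vec F 3 A (residue_vec 3 x) = vec_rsmult F 3 (residue_vec 3 y) (\<pi> r)"
    unfolding res[symmetric] r(2) by (rule residue_vec_rsmult[OF y(1) r(1)])
  have "v \<in> right_span F 3 (mat_vec F 3 A (residue_vec 3 x))"
    using F.right_span_self[OF v(1)] A F.mat_act_right_span[OF lift(1) residue_vec_closed[OF x]] by simp
  then obtain c where c: "c \<in> carrier F" "v = vec_rsmult F 3 (mat_vec F 3 A (residue_vec 3 x)) c"
    unfolding right_span_def by blast
  have v_eq: "v = vec_rsmult F 3 (residue_vec 3 y) (\<pi> r \<otimes>\<^bsub>F\<^esub> c)"
    unfolding c(2) Ax using F.vec_rsmult_assoc[OF residue_vec_closed[OF y(1)] residue_closed[OF r(1)] c(1)] .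
  have "\<pi> r \<otimes>\<^bsub>F\<^esub> c \<noteq> \<zero>\<^bsub>F\<^esub>"
  proof
    assume "\<pi> r \<otimes>\<^bsub>F\<^esub> c = \<zero>\<^bsub>F\<^esub>"
    then have "v = vec_zero F 3"
      unfolding v_eq using y(1) by (intro vecs_eqI[OF _ vec_zero_in(2)]) (auto simp: vec_rsmult_def vec_zero_def vecs_apply[of y R 3])
    then show False using v(2) by simp
  qed
  then show ?thesis using v_eq r(1) c(1) by blast
qed

end

context covering_arc
begin

text \<open>  What remains to be seen is that the three rows are distinct, as a generating set of exactly three
  codewords is wanted: equal rows \<open>i\<close> and \<open>k\<close> would make \<open>e\<^sub>i - e\<^sub>k\<close> a nonzero vector of weight \<open>0\<close>.\<close>

lemma two_weight_row_code:
  assumes Y: "Y \<in> mats R 3 n" and y_eq: "\<And>j. j < n \<Longrightarrow> y j = mat_col 3 Y j"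
  shows "k_generated_code R n 3 (row_code R 3 n Y) \<and>
    two_weight_code R n (row_code R 3 n Y) (real q ^ 3 / (real q - 1)) (real q ^ 2)"
proof
  have entry: "vec_mat R 3 n x Y j = dot R 3 x (y j)" if "x \<in> vecs R 3" "j < n" for x j
    using that Y y_eq by (simp add: R.vec_mat_apply)
  have weight: "whom_vec R n (vec_mat R 3 n x Y) = sum_weight n y x" if "x \<in> vecs R 3" for x
    unfolding whom_vec_def sum_weight_def whom_eq using entry[OF that] by simp
  have pos: "0 < sum_weight n y x" if "x \<in> vecs R 3" "x \<noteq> vec_zero R 3" for x
    using sum_weight_nonzero[OF that] weights_distinct(2,3) by auto
  have whom_zero: "whom_vec R n (vec_zero R n) = 0"
    by (simp add: whom_vec_def vec_zero_def whom_eq weight_def)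
  have kernel: "x = vec_zero R 3" if "x \<in> vecs R 3" "vec_mat R 3 n x Y = vec_zero R n" for x
    using weight[OF that(1)] pos[OF that(1)] whom_zero unfolding that(2) by auto
  have "inj_on Y {..<3}"
  proof (rule inj_onI, rule ccontr)
    fix i k :: nat assume ik: "i \<in> {..<3}" "k \<in> {..<3}" "Y i = Y k" "i \<noteq> k"
    let ?x = "vec_add R 3 (R.coord_vec 3 i \<one>) (R.coord_vec 3 k (\<ominus> \<one>))"
    have x: "?x \<in> vecs R 3" by simp
    have "vec_mat R 3 n ?x Y = vec_add R n (vec_lsmult R n \<one> (Y i)) (vec_lsmult R n (\<ominus> \<one>) (Y i))"
      using ik Y by (simp add: R.vec_mat_add R.vec_mat_coord)
    also have "\<dots> = vec_zero R n"
      using ik mats_row[OF Y, of i]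
      by (intro vecs_eqI[of _ R n]) (auto simp: vec_add_def vec_lsmult_def vec_zero_def R.l_minus R.r_neg)
    finally have "?x = vec_zero R 3" using kernel[OF x] by simp
    then have "?x i = vec_zero R 3 i" by (rule fun_cong)
    then have "\<one> = \<zero>"
      using ik by (simp add: vec_add_def vec_zero_def R.coord_vec_def)
    then have "\<pi> \<one> = \<pi> \<zero>" by simp
    then show False by simp
  qed
  then show "k_generated_code R n 3 (row_code R 3 n Y)" by (rule R.k_generated_row_code[OF Y])
  have image: "whom_vec R n ` row_code R 3 n Y = sum_weight n y ` vecs R 3"
  proof -
    have "row_code R 3 n Y = (\<lambda>x. vec_mat R 3 n x Y) ` vecs R 3" by (auto simp: row_code_def)
    then show ?thesis by (simp add: image_image weight)
  qed
  show "two_weight_code R n (row_code R 3 n Y) (real q ^ 3 / (real q - 1)) (real q ^ 2)"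
    unfolding two_weight_code_def image
  proof (intro conjI ballI impI)
    show "left_linear_code R n (row_code R 3 n Y)" using Y by (rule R.left_linear_row_code)
    show "real q ^ 3 / (real q - 1) \<noteq> real q ^ 2" by (rule weights_distinct(1))
    show "sum_weight n y ` vecs R 3 - {0} = {real q ^ 3 / (real q - 1), real q ^ 2}" by (rule sum_weight_image)
    fix c assume "c \<in> row_code R 3 n Y" "c \<noteq> vec_zero R n"
    then obtain x where x: "x \<in> vecs R 3" "c = vec_mat R 3 n x Y" unfolding row_code_def by blast
    have "x \<noteq> vec_zero R 3" using \<open>c \<noteq> vec_zero R n\<close> x(2) R.vec_mat_zero[OF Y] by auto
    then show "0 < whom_vec R n c" unfolding x(2) weight[OF x(1)] by (rule pos[OF x(1)])
  qed
qed

end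

section \<open>The code of an orbit of an embedded Singer cycle\<close>

theorem proposition6p3:
  fixes F :: "('a, 'm) ring_scheme"
    and \<sigma> :: "'a \<Rightarrow> 'a"
    and R :: "(nat \<Rightarrow> 'a) set ring"
    and S :: "nat \<Rightarrow> nat \<Rightarrow> 'a"
    and C :: "(nat \<Rightarrow> nat \<Rightarrow> 'a) set set"
    and p :: "(nat \<Rightarrow> (nat \<Rightarrow> 'a) set) set"
    and K :: "(nat \<Rightarrow> (nat \<Rightarrow> 'a) set) set set"
    and Y :: "nat \<Rightarrow> nat \<Rightarrow> (nat \<Rightarrow> 'a) set"
    and q n :: nat
  assumes "field F" and "finite (carrier F)" and "q = card (carrier F)"
    and "\<sigma> \<in> ring_iso F F"
    and "R = skew_chain_ring F \<sigma>"
    and "singer_cycle F C"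
    and "S \<in> carrier (GL F 3)"
    and "C = generate (PGL F 3) {scalar_mats F 3 #>\<^bsub>GL F 3\<^esub> S}"
    and "p \<in> barbilian_points R 3"
    and "K = embedded_orbit F \<sigma> S p"
    and "n = q ^ 2 + q + 1"
    and "card K = n"
    and "\<And>H. H \<in> barbilian_hyperplanes R 3 \<Longrightarrow> card {P \<in> K. lies_on R 3 P H} \<in> {1, q + 1}"
    and "Y \<in> mats R 3 n"
    and "bij_betw (\<lambda>j. right_span R 3 (mat_col 3 Y j)) {..<n} K"
  shows "k_generated_code R n 3 (row_code R 3 n Y) \<and>
    two_weight_code R n (row_code R 3 n Y) (real q ^ 3 / (real q - 1)) (real q ^ 2)"
proof -
  interpret A: field_automorphism F \<sigma>
    using assms(1,4) by (intro field_automorphism.intro field_automorphism_axioms.intro)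
  interpret chain_ring_of_length_two R F \<sigma> A.residue "const_embed F \<sigma>" A.linear_part
    unfolding assms(5) by (rule A.chain_ring_skew_chain_ring[OF assms(2)])
  note q = assms(3) and Y = assms(14) and bij = assms(15)
  let ?y = "mat_col 3 Y"
  have y: "?y j \<in> vecs R 3" if "j < n" for j using mats_col[OF Y that] .
  obtain x \<phi> where x: "x \<in> vecs R 3" "p = right_span R 3 x" and \<phi>: "\<phi> \<in> right_forms R 3" "\<phi> x = \<one>\<^bsub>R\<^esub>"
    using assms(9) unfolding barbilian_points_def by blast
  have x0: "residue_vec 3 x \<noteq> vec_zero F 3" by (rule unimodular_residue[OF x(1) \<phi>])
  interpret covering_arc R F \<sigma> A.residue "const_embed F \<sigma>" A.linear_part n ?y
  proof (unfold_locales)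
    show "n = card (carrier F) ^ 2 + card (carrier F) + 1" using assms(11) unfolding q .
    show "?y j \<in> vecs R 3" if "j < n" for j using y[OF that] .
    show "card (zeros n ?y z) \<in> {1, card (carrier F) + 1}"
      if "z \<in> vecs R 3" "residue_vec 3 z \<noteq> vec_zero F 3" for z
      using card_points_on_hyperplane[OF y bij assms(13) that] unfolding q .
    fix v assume v: "v \<in> vecs F 3" "v \<noteq> vec_zero F 3"
    obtain A where A: "A \<in> generate (GL F 3) {S}" "A \<in> mats F 3 3"
      "mat_act F 3 A (right_span F 3 (residue_vec 3 x)) = right_span F 3 v"
      using field.singer_cycle_transitive[OF assms(1,6-8) residue_vec_closed[OF x(1)] x0 v] by blast
    let ?A = "const_embed_mat F \<sigma> 3 A"
    have A': "?A \<in> mats R 3 3" unfolding const_embed_mat_def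
      by (intro matsI restrict_vecs lift_closed mats_entry[OF A(2)])
    have "mat_act R 3 ?A p \<in> K" unfolding assms(5,10) embedded_orbit_def using A(1) by blast
    then obtain j where j: "j < n" "mat_act R 3 ?A p = right_span R 3 (?y j)"
      using bij by (auto simp: bij_betw_def)
    have "\<exists>c\<in>carrier F - {\<zero>\<^bsub>F\<^esub>}. v = vec_rsmult F 3 (residue_vec 3 (?y j)) c"
      using A' x(1) v A(3) y[OF j(1)] j(2)[unfolded x(2)]
      by (intro orbit_covers_residue_plane[OF A(2)]) (simp_all add: const_embed_mat_def residue_lift mats_entry[OF A(2)])
    then show "\<exists>j<n. \<exists>c\<in>carrier F - {\<zero>\<^bsub>F\<^esub>}. v = vec_rsmult F 3 (residue_vec 3 (?y j)) c"
      using j(1) by blast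
  qed
  show ?thesis unfolding q by (rule two_weight_row_code[OF Y refl])
qed

end
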